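(* For $\alpha=(a,1,1,1,1,1)$, the graph $\mathcal{F}_\alpha$ has no Hamilton cycle for any $a\geq 1$, but it has a Hamilton path for $a=2$ and for every $a\geq 4$.
   Context: Let $N=a+5$ and label the points of a convex $N$-gon $1,\ldots,N$ counterclockwise; color the first $a$ points red, and then the remaining five points blue, red, blue, red, blue. The associahedron $\mathcal{G}_N$ has as nodes all triangulations of the convex $N$-gon, two adjacent if they differ in a flip (removing a diagonal shared by two triangles and replacing it by the other diagonal of the resulting quadrilateral). A triangulation is colorful if no triangle has all three points of the same color; $\mathcal{F}_\alpha$ is the subgraph of $\mathcal{G}_N$ induced by the colorful triangulations. *)

theory Defs
  imports Main
begin

section \<open>Simple graphs\<close>

type_synonym 'a graph = "'a set \<times> 'a set set"

definition induced_subgraph :: "'a graph \<Rightarrow> 'a set \<Rightarrow> 'a graph" where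
  "induced_subgraph G W = (fst G \<inter> W, {e \<in> snd G. e \<subseteq> fst G \<inter> W})"

definition hamilton_path :: "'a graph \<Rightarrow> 'a list \<Rightarrow> bool" where
  "hamilton_path G vs \<longleftrightarrow>
     vs \<noteq> [] \<and> distinct vs \<and> set vs = fst G \<and> successively (\<lambda>u v. {u, v} \<in> snd G) vs"

definition hamilton_cycle :: "'a graph \<Rightarrow> 'a list \<Rightarrow> bool" where
  "hamilton_cycle G vs \<longleftrightarrow>
     length vs \<ge> 3 \<and> hamilton_path G vs \<and> {last vs, hd vs} \<in> snd G"

definition has_hamilton_path :: "'a graph \<Rightarrow> bool" where
  "has_hamilton_path G \<longleftrightarrow> (\<exists>vs. hamilton_path G vs)"

definition has_hamilton_cycle :: "'a graph \<Rightarrow> bool" where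
  "has_hamilton_cycle G \<longleftrightarrow> (\<exists>vs. hamilton_cycle G vs)"

section \<open>Triangulations of a convex polygon\<close>

text \<open>The points of the convex \<open>N\<close>-gon are \<open>1, \<dots>, N\<close> in counterclockwise order;
  a segment between two points is the set of its two endpoints. Since the points are in
  convex position, two segments meet in their interiors iff their endpoints alternate
  along the boundary.\<close>

definition segments :: "nat \<Rightarrow> nat set set" where
  "segments N = {{i, j} | i j. i \<in> {1..N} \<and> j \<in> {1..N} \<and> i \<noteq> j}"

definition sides :: "nat \<Rightarrow> nat set set" where
  "sides N = {{i, Suc i} | i. 1 \<le> i \<and> i < N} \<union> {{N, 1}}"

definition diagonals :: "nat \<Rightarrow> nat set set" where
  "diagonals N = segments N - sides N"

definition crossing :: "nat set \<Rightarrow> nat set \<Rightarrow> bool" where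
  "crossing d e \<longleftrightarrow>
     (\<exists>i j k l. i < j \<and> j < k \<and> k < l \<and>
        (d = {i, k} \<and> e = {j, l} \<or> d = {j, l} \<and> e = {i, k}))"

definition noncrossing :: "nat set set \<Rightarrow> bool" where
  "noncrossing T \<longleftrightarrow> (\<forall>d\<in>T. \<forall>e\<in>T. \<not> crossing d e)"

text \<open>A triangulation is represented by its diagonals: an inclusion-maximal set of pairwise
  noncrossing diagonals.\<close>

definition triangulation :: "nat \<Rightarrow> nat set set \<Rightarrow> bool" where
  "triangulation N T \<longleftrightarrow>
     T \<subseteq> diagonals N \<and> noncrossing T \<and>
     (\<forall>S. T \<subseteq> S \<and> S \<subseteq> diagonals N \<and> noncrossing S \<longrightarrow> S = T)"

text \<open>No polygon point lies inside a triangle spanned by three of them, so three points whose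
  connecting segments are all present bound a face.\<close>

definition triangles :: "nat \<Rightarrow> nat set set \<Rightarrow> nat set set" where
  "triangles N T =
     {{i, j, k} | i j k. i \<noteq> j \<and> j \<noteq> k \<and> i \<noteq> k \<and>
        {{i, j}, {j, k}, {i, k}} \<subseteq> sides N \<union> T}"

text \<open>\<open>{i, j}\<close> is shared by the two triangles \<open>ijk\<close> and \<open>ijl\<close>, which together form a
  quadrilateral whose other diagonal is \<open>{k, l}\<close>.\<close>

definition flip :: "nat \<Rightarrow> nat set set \<Rightarrow> nat set set \<Rightarrow> bool" where
  "flip N T T' \<longleftrightarrow>
     (\<exists>i j k l. {i, j} \<in> T \<and> k \<noteq> l \<and>
        {i, j, k} \<in> triangles N T \<and> {i, j, l} \<in> triangles N T \<and>
        k \<notin> {i, j} \<and> l \<notin> {i, j} \<and>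
        T' = insert {k, l} (T - {{i, j}}))"

definition associahedron :: "nat \<Rightarrow> nat set set graph" where
  "associahedron N =
     ({T. triangulation N T},
      {{T, T'} | T T'. triangulation N T \<and> triangulation N T' \<and> (flip N T T' \<or> flip N T' T)})"

section \<open>Colorful triangulations\<close>

datatype color = Red | Blue

text \<open>For \<open>\<alpha> = (\<alpha>\<^sub>1, \<dots>, \<alpha>\<^sub>k)\<close> the points \<open>1, 2, \<dots>\<close> are colored in consecutive blocks of sizes
  \<open>\<alpha>\<^sub>1, \<dots>, \<alpha>\<^sub>k\<close>, alternately red and blue, starting with red. Lists are indexed from \<open>0\<close>.\<close>

definition color_sequence :: "nat list \<Rightarrow> color list" where
  "color_sequence \<alpha> =
     concat (map (\<lambda>i. replicate (\<alpha> ! i) (if even i then Red else Blue)) [0..<length \<alpha>])"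

definition point_color :: "nat list \<Rightarrow> nat \<Rightarrow> color" where
  "point_color \<alpha> p = color_sequence \<alpha> ! (p - 1)"

definition colorful :: "nat list \<Rightarrow> nat set set \<Rightarrow> bool" where
  "colorful \<alpha> T \<longleftrightarrow>
     (\<forall>t \<in> triangles (sum_list \<alpha>) T. \<not> (\<exists>c. \<forall>p\<in>t. point_color \<alpha> p = c))"

definition colorful_flip_graph :: "nat list \<Rightarrow> nat set set graph" where
  "colorful_flip_graph \<alpha> = induced_subgraph (associahedron (sum_list \<alpha>)) {T. colorful \<alpha> T}"

lemma sum_list_a11111: "sum_list [a, 1, 1, 1, 1, 1 :: nat] = a + 5"
  by simp

lemma color_sequence_a11111:
  "color_sequence [a, 1, 1, 1, 1, 1] = replicate a Red @ [Blue, Red, Blue, Red, Blue]"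
  by (simp add: color_sequence_def upt_rec)

end

theory Submission
  imports Defs
begin

text \<open>A colorful triangulation consists of \<open>a - 1\<close> triangles on the sides between the first \<open>a\<close> points and of two
  quadrilaterals with a free choice of the monochromatic diagonal. This gives explicit coordinates for
  the flip graph.

  No Hamilton cycle: the nodes that contain an edge from \<open>a + 3\<close> to one of \<open>1, \<dots>, a\<close> induce a bipartite
  graph with two classes of equal size, and only one of the classes has neighbors outside. A Hamilton
  cycle would have to alternate between the two classes forever and never reach the other nodes.

  Hamilton path: starting from explicit paths for \<open>a = 2\<close> and \<open>a = 5\<close>, a Hamilton path for \<open>a\<close> is
  extended to one for \<open>a + 2\<close> by replacing single edges with detours through blocks of new nodes. Every
  detour again contains edges at which the next detours can be inserted.\<close>

section \<open>Triangulations of a convex polygon\<close>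

text \<open>The two classes for the cycle are given by the parity of \<open>q + s + t\<close>.
  Inside the \<open>M\<close> cells a flip changes exactly one of \<open>q\<close>,
  \<open>s\<close>, \<open>t\<close>: a triangle passing from the middle blue point to
  \<open>a + 1\<close>, or between \<open>a + 5\<close> and \<open>a + 3\<close>, changes
  \<open>q\<close> by one, and a flip in a quadrilateral toggles a bit. Leaving the \<open>M\<close>
  cells means flipping the only remaining edge from \<open>a + 3\<close> to the red block, which
  forces \<open>q = 0\<close> and exactly one true bit. Hence the even class has all its neighbors
  in the odd class. For the paths, the \<open>M\<close> cells form a triangular grid of pairs
  \<open>(p, q)\<close> with a 4-cycle of bits over each pair. Passing from \<open>a\<close> to
  \<open>a + 2\<close> adds two antidiagonals of this grid. Pairing adjacent columns cuts them into
  groups of four grid points, each of which carries a detour with both ends next to one old 4-cycle;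
  this is why the step is two. The odd chain therefore has a start of its own, and since the
  statement claims nothing for 3 it starts at 5.\<close>

definition chords :: "(nat \<Rightarrow> nat \<Rightarrow> bool) \<Rightarrow> nat set set" where
  "chords E = {{i, j} | i j. i < j \<and> E i j}"

lemma mem_chords: "i < j \<Longrightarrow> {i, j} \<in> chords E \<longleftrightarrow> E i j"
  unfolding chords_def by (auto simp: doubleton_eq_iff)

lemma mem_sides: "0 < N \<Longrightarrow> i < j \<Longrightarrow> {i, j} \<in> sides N \<longleftrightarrow> 1 \<le> i \<and> j \<le> N \<and> (j = Suc i \<or> i = 1 \<and> j = N)"
  unfolding sides_def by (auto simp: doubleton_eq_iff)

lemma mem_segments: "i < j \<Longrightarrow> {i, j} \<in> segments N \<longleftrightarrow> 1 \<le> i \<and> j \<le> N"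
proof
  show "1 \<le> i \<and> j \<le> N" if "i < j" "{i, j} \<in> segments N"
    using that unfolding segments_def by (auto simp: doubleton_eq_iff)
  show "{i, j} \<in> segments N" if "i < j" "1 \<le> i \<and> j \<le> N"
    using that unfolding segments_def by (intro CollectI exI[of _ i] exI[of _ j]) auto
qed

lemma mem_diagonals:
  "i < j \<Longrightarrow> {i, j} \<in> diagonals N \<longleftrightarrow> 1 \<le> i \<and> i + 2 \<le> j \<and> j \<le> N \<and> \<not> (i = 1 \<and> j = N)"
  by (cases "N = 0") (auto simp: diagonals_def mem_sides mem_segments)

lemma diagonalE:
  assumes "d \<in> diagonals N"
  obtains i j where "i < j" "d = {i, j}"
  using assms unfolding diagonals_def segments_def
  by (auto simp: insert_commute elim!: neqE)

lemma crossing_iff: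
  assumes "i < j" "k < l"
  shows "crossing {i, j} {k, l} \<longleftrightarrow> i < k \<and> k < j \<and> j < l \<or> k < i \<and> i < l \<and> l < j"
  using assms unfolding crossing_def by (auto simp: doubleton_eq_iff)

text \<open>Reduces the definition to arithmetic on ordered pairs. One of the two alternation
  patterns suffices in \<open>nc\<close>, since exchanging the two chords gives the other.\<close>

lemma triangulation_chordsI:
  assumes diag: "\<And>i j. i < j \<Longrightarrow> E i j \<Longrightarrow> 1 \<le> i \<and> i + 2 \<le> j \<and> j \<le> N \<and> \<not> (i = 1 \<and> j = N)"
    and nc: "\<And>i j k l. E i j \<Longrightarrow> E k l \<Longrightarrow> i < k \<Longrightarrow> k < j \<Longrightarrow> j < l \<Longrightarrow> False"
    and max: "\<And>i j. 1 \<le> i \<Longrightarrow> i + 2 \<le> j \<Longrightarrow> j \<le> N \<Longrightarrow> \<not> (i = 1 \<and> j = N) \<Longrightarrow>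
      (\<And>k l. k < l \<Longrightarrow> E k l \<Longrightarrow> \<not> (i < k \<and> k < j \<and> j < l) \<and> \<not> (k < i \<and> i < l \<and> l < j)) \<Longrightarrow> E i j"
  shows "triangulation N (chords E)"
  unfolding triangulation_def
proof (intro conjI allI impI)
  show "chords E \<subseteq> diagonals N"
  proof
    fix d assume "d \<in> chords E"
    then obtain i j where "i < j" "d = {i, j}" "E i j" unfolding chords_def by blast
    then show "d \<in> diagonals N" using diag mem_diagonals by blast
  qed
  show "noncrossing (chords E)"
    unfolding noncrossing_def
  proof (intro ballI notI)
    fix d e assume "d \<in> chords E" "e \<in> chords E" "crossing d e"
    moreover from this obtain i j k l where "i < j" "d = {i, j}" "E i j" "k < l" "e = {k, l}" "E k l"
      unfolding chords_def by blast
    ultimately show False using nc crossing_iff by metis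
  qed
  fix S assume S: "chords E \<subseteq> S \<and> S \<subseteq> diagonals N \<and> noncrossing S"
  show "S = chords E"
  proof
    show "S \<subseteq> chords E"
    proof
      fix d assume d: "d \<in> S"
      then obtain i j where ij: "i < j" "d = {i, j}" using S diagonalE by blast
      have dd: "1 \<le> i" "i + 2 \<le> j" "j \<le> N" "\<not> (i = 1 \<and> j = N)"
        using d S ij mem_diagonals by auto
      have "E i j"
      proof (rule max[OF dd])
        fix k l assume "k < l" "E k l"
        then have "{k, l} \<in> S" using S mem_chords by blast
        then show "\<not> (i < k \<and> k < j \<and> j < l) \<and> \<not> (k < i \<and> i < l \<and> l < j)"
          using S d ij \<open>k < l\<close> crossing_iff[of i j k l] unfolding noncrossing_def by blast
      qed
      then show "d \<in> chords E" using ij mem_chords by simp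
    qed
  qed (use S in blast)
qed

text \<open>Otherwise the segment would be a diagonal that could be added to \<open>T\<close>,
  against maximality.\<close>

lemma triangulation_maximal:
  assumes T: "triangulation N T" and ij: "1 \<le> i" "i < j" "j \<le> N"
    and nc: "\<And>k l. k < l \<Longrightarrow> {k, l} \<in> T \<Longrightarrow> \<not> (i < k \<and> k < j \<and> j < l) \<and> \<not> (k < i \<and> i < l \<and> l < j)"
  shows "{i, j} \<in> sides N \<union> T"
proof (rule ccontr)
  assume not: "{i, j} \<notin> sides N \<union> T"
  then have dia: "{i, j} \<in> diagonals N"
    using ij mem_segments[of i j N] by (auto simp: diagonals_def)
  have no: "\<not> crossing {i, j} d \<and> \<not> crossing d {i, j}" if "d \<in> T" for d
  proof -
    have "d \<in> diagonals N" using that T unfolding triangulation_def by blast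
    then obtain k l where "k < l" "d = {k, l}" by (rule diagonalE)
    then show ?thesis using nc[of k l] that ij crossing_iff[of i j k l] crossing_iff[of k l i j] by auto
  qed
  have "\<not> crossing {i, j} {i, j}" using ij crossing_iff[of i j i j] by auto
  then have "noncrossing (insert {i, j} T)"
    using no T unfolding triangulation_def noncrossing_def by auto
  then have "insert {i, j} T = T"
    using T dia unfolding triangulation_def by (meson insert_subset subset_insertI)
  then show False using not by auto
qed

lemma edge_bounds:
  assumes "0 < N" "triangulation N T" "{i, j} \<in> sides N \<union> T" "i < j"
  shows "1 \<le> i" "j \<le> N"
  using assms mem_sides[of N i j] mem_diagonals[of i j N] unfolding triangulation_def by auto

lemma edges_noncrossing:
  assumes N: "0 < N" and T: "triangulation N T"
    and "{i, j} \<in> sides N \<union> T" "{k, l} \<in> sides N \<union> T"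
    and "i < k" "k < j" "j < l"
  shows False
proof -
  have "i < j" "k < l" using assms by auto
  have "{i, j} \<notin> sides N" "{k, l} \<notin> sides N"
    using assms(5-) edge_bounds[OF N T assms(3)] edge_bounds[OF N T assms(4)] by (auto simp: mem_sides)
  then have "{i, j} \<in> T" "{k, l} \<in> T" using assms by auto
  then show False
    using T crossing_iff[OF \<open>i < j\<close> \<open>k < l\<close>] assms(5-) unfolding triangulation_def noncrossing_def by blast
qed

text \<open>The apex is the largest \<open>k\<close> joined to \<open>i\<close>: a diagonal crossing \<open>{k, j}\<close> would have to end in \<open>i\<close>.\<close>

lemma triangulation_apex:
  assumes N: "0 < N" and T: "triangulation N T" and ij: "{i, j} \<in> sides N \<union> T" "Suc i < j"
  obtains k where "i < k" "k < j" "{i, k} \<in> sides N \<union> T" "{k, j} \<in> sides N \<union> T"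
proof -
  have bd: "1 \<le> i" "j \<le> N" using edge_bounds[OF N T ij(1)] ij(2) by auto
  define K where "K = {k. i < k \<and> k < j \<and> {i, k} \<in> sides N \<union> T}"
  have "finite K" by (rule finite_subset[of _ "{..j}"]) (auto simp: K_def)
  moreover have "Suc i \<in> K" using bd ij(2) by (auto simp: K_def mem_sides)
  ultimately have Max: "Max K \<in> K" "\<And>x. x \<in> K \<Longrightarrow> x \<le> Max K" by (auto intro: Max_in)
  define k where "k = Max K"
  have k: "i < k" "k < j" "{i, k} \<in> sides N \<union> T" using Max(1) by (auto simp: K_def k_def)
  have "{k, j} \<in> sides N \<union> T"
  proof (rule triangulation_maximal[OF T])
    fix x y assume xy: "x < y" "{x, y} \<in> T"
    have "\<not> (k < x \<and> x < j \<and> j < y)"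
      using edges_noncrossing[OF N T ij(1), of x y] xy k by auto
    moreover have False if h: "x < k" "k < y" "y < j"
    proof -
      have "\<not> x < i" using edges_noncrossing[OF N T _ ij(1), of x y] xy h k by auto
      moreover have "\<not> i < x" using edges_noncrossing[OF N T k(3), of x y] xy h by auto
      ultimately have "y \<in> K" using xy h k by (auto simp: K_def)
      then show False using Max(2) h k_def by fastforce
    qed
    ultimately show "\<not> (k < x \<and> x < j \<and> j < y) \<and> \<not> (x < k \<and> k < y \<and> y < j)" by blast
  qed (use k bd in auto)
  then show thesis using that k by blast
qed

lemma trianglesE:
  assumes "t \<in> triangles N T"
  obtains i j k where "i < j" "j < k" "t = {i, j, k}"
    "{i, j} \<in> sides N \<union> T" "{j, k} \<in> sides N \<union> T" "{i, k} \<in> sides N \<union> T"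
proof -
  obtain x y z where xyz: "t = {x, y, z}" "x \<noteq> y" "y \<noteq> z" "x \<noteq> z"
    "{x, y} \<in> sides N \<union> T" "{y, z} \<in> sides N \<union> T" "{x, z} \<in> sides N \<union> T"
    using assms unfolding triangles_def by auto
  have sym: "{y, x} \<in> sides N \<union> T" "{z, y} \<in> sides N \<union> T" "{z, x} \<in> sides N \<union> T"
    using xyz by (simp_all add: insert_commute)
  have perm: "t = {x, z, y}" "t = {y, x, z}" "t = {y, z, x}" "t = {z, x, y}" "t = {z, y, x}"
    using xyz(1) by auto
  consider "x < y" "y < z" | "x < z" "z < y" | "y < x" "x < z" | "y < z" "z < x" | "z < x" "x < y" | "z < y" "y < x"
    using xyz by linarith
  then show thesis by cases (use that xyz perm sym in blast)+
qed

lemma trianglesI: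
  assumes "i < j" "j < k" "{i, j} \<in> sides N \<union> T" "{j, k} \<in> sides N \<union> T" "{i, k} \<in> sides N \<union> T"
  shows "{i, j, k} \<in> triangles N T"
  using assms unfolding triangles_def by (intro CollectI exI[of _ i] exI[of _ j] exI[of _ k]) auto

section \<open>Colors of the points and monochromatic triangles\<close>

lemma point_color_a11111:
  assumes "1 \<le> x" "x \<le> a + 5"
  shows "point_color [a, 1, 1, 1, 1, 1] x = (if x \<in> {a + 1, a + 3, a + 5} then Blue else Red)"
proof -
  consider "x \<le> a" | "x = a + 1" | "x = a + 2" | "x = a + 3" | "x = a + 4" | "x = a + 5"
    using assms by linarith
  then show ?thesis
    unfolding point_color_def color_sequence_a11111
    by cases (use assms in \<open>auto simp: nth_append numeral_eq_Suc\<close>)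
qed

text \<open>With two colors, monochromatic means contained in or disjoint from the set of blue
  points. The corners lie in \<open>1..a + 5\<close> by \<open>edge_bounds\<close>, so
  \<open>point_color\<close> never indexes outside its list.\<close>

lemma colorful_iff:
  assumes "triangulation (a + 5) T"
  shows "colorful [a, 1, 1, 1, 1, 1] T \<longleftrightarrow>
    (\<forall>i j k. i < j \<longrightarrow> j < k \<longrightarrow> {i, j} \<in> sides (a + 5) \<union> T \<longrightarrow> {j, k} \<in> sides (a + 5) \<union> T \<longrightarrow>
      {i, k} \<in> sides (a + 5) \<union> T \<longrightarrow>
      \<not> ({i, j, k} \<subseteq> {a + 1, a + 3, a + 5} \<or> {i, j, k} \<inter> {a + 1, a + 3, a + 5} = {}))" (is "_ \<longleftrightarrow> ?R")
proof -
  have mono: "(\<exists>c. \<forall>p\<in>{i, j, k}. point_color [a, 1, 1, 1, 1, 1] p = c) \<longleftrightarrow>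
      {i, j, k} \<subseteq> {a + 1, a + 3, a + 5} \<or> {i, j, k} \<inter> {a + 1, a + 3, a + 5} = {}"
    if "i < j" "j < k" "{i, k} \<in> sides (a + 5) \<union> T" for i j k
  proof -
    have "1 \<le> i" "k \<le> a + 5" using edge_bounds[OF _ assms that(3)] that by auto
    then have c: "point_color [a, 1, 1, 1, 1, 1] p = (if p \<in> {a + 1, a + 3, a + 5} then Blue else Red)"
      if "p \<in> {i, j, k}" for p
      using that \<open>i < j\<close> \<open>j < k\<close> by (intro point_color_a11111) auto
    have "(\<exists>c. \<forall>p\<in>{i, j, k}. point_color [a, 1, 1, 1, 1, 1] p = c) \<longleftrightarrow>
      (\<forall>p\<in>{i, j, k}. p \<in> {a + 1, a + 3, a + 5}) \<or> (\<forall>p\<in>{i, j, k}. p \<notin> {a + 1, a + 3, a + 5})"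
      using c by (metis (no_types, lifting) color.distinct(1) insertCI)
    then show ?thesis by blast
  qed
  show ?thesis
    unfolding colorful_def sum_list_a11111
  proof (intro iffI allI impI ballI)
    fix i j k assume "\<forall>t\<in>triangles (a + 5) T. \<not> (\<exists>c. \<forall>p\<in>t. point_color [a, 1, 1, 1, 1, 1] p = c)"
      and ijk: "i < j" "j < k" "{i, j} \<in> sides (a + 5) \<union> T" "{j, k} \<in> sides (a + 5) \<union> T" "{i, k} \<in> sides (a + 5) \<union> T"
    from bspec[OF this(1) trianglesI[OF ijk]]
    show "\<not> ({i, j, k} \<subseteq> {a + 1, a + 3, a + 5} \<or> {i, j, k} \<inter> {a + 1, a + 3, a + 5} = {})"
      unfolding mono[OF ijk(1,2,5)] .
  next
    fix t assume R: ?R and "t \<in> triangles (a + 5) T"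
    from this(2) show "\<not> (\<exists>c. \<forall>p\<in>t. point_color [a, 1, 1, 1, 1, 1] p = c)"
    proof (rule trianglesE)
      fix i j k assume ijk: "i < j" "j < k" "t = {i, j, k}" "{i, j} \<in> sides (a + 5) \<union> T"
        "{j, k} \<in> sides (a + 5) \<union> T" "{i, k} \<in> sides (a + 5) \<union> T"
      show ?thesis unfolding ijk(3) mono[OF ijk(1,2,6)] by (rule R[rule_format, OF ijk(1,2,4,5,6)])
    qed
  qed
qed

section \<open>Coordinates for colorful triangulations\<close>

text \<open>Write \<open>B\<^sub>1, R\<^sub>1, B\<^sub>2, R\<^sub>2, B\<^sub>3\<close> for the points \<open>a + 1, \<dots>, a + 5\<close>. Every triangle of a
  colorful triangulation has exactly one monochromatic edge, so deleting the monochromatic diagonals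
  leaves \<open>a - 1\<close> triangles with a red base \<open>{i, i + 1}\<close> and a blue apex, and two quadrilaterals.
  Contracting the points \<open>1, \<dots>, a\<close> to a single point \<open>x\<close> turns this into a quadrangulated hexagon
  \<open>x B\<^sub>1 R\<^sub>1 B\<^sub>2 R\<^sub>2 B\<^sub>3\<close>, whose diagonal is \<open>x B\<^sub>2\<close> (cells \<open>M\<close>), \<open>B\<^sub>1 R\<^sub>2\<close> (cells \<open>L\<close>) or
  \<open>R\<^sub>1 B\<^sub>3\<close> (cells \<open>R\<close>). The numbers \<open>p\<close> and \<open>q\<close> count the triangles with apex \<open>B\<^sub>3\<close> and \<open>B\<^sub>2\<close>; each
  Boolean tells whether the monochromatic diagonal of one of the two quadrilaterals is blue.\<close>

datatype cell = M nat nat bool bool | L nat bool bool | R nat bool bool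

fun valid :: "nat \<Rightarrow> cell \<Rightarrow> bool" where
  "valid a (M p q s t) \<longleftrightarrow> p + q < a"
| "valid a (L p s t) \<longleftrightarrow> p < a"
| "valid a (R p s t) \<longleftrightarrow> p < a"

text \<open>The flips between cells do not involve \<open>a\<close>, so the flip graphs for increasing \<open>a\<close> are
  nested induced subgraphs of one infinite graph.\<close>

fun arc :: "cell \<Rightarrow> cell \<Rightarrow> bool" where
  "arc (M p q s t) (M p' q' s' t') \<longleftrightarrow>
     p = p' \<and> q = q' \<and> \<not> s \<and> s' \<and> t = t' \<or>
     p = p' \<and> q = q' \<and> s = s' \<and> \<not> t \<and> t' \<or>
     p = Suc p' \<and> q' = Suc q \<and> s = s' \<and> t \<and> t' \<or>
     p = p' \<and> q = Suc q' \<and> s \<and> s' \<and> t = t'"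
| "arc (M p q s t) (L p' s' t') \<longleftrightarrow> p = p' \<and> q = 0 \<and> s \<and> \<not> t \<and> s' \<and> \<not> t'"
| "arc (M p q s t) (R p' s' t') \<longleftrightarrow> p = p' \<and> q = 0 \<and> \<not> s \<and> t \<and> s' \<and> \<not> t'"
| "arc (L p s t) (L p' s' t') \<longleftrightarrow>
     p = p' \<and> \<not> s \<and> s' \<and> t = t' \<or> p = p' \<and> s = s' \<and> \<not> t \<and> t' \<or>
     p = Suc p' \<and> s = s' \<and> t \<and> t'"
| "arc (L p s t) (R p' s' t') \<longleftrightarrow> p = p' \<and> \<not> s \<and> t \<and> \<not> s' \<and> t'"
| "arc (R p s t) (R p' s' t') \<longleftrightarrow>
     p = p' \<and> \<not> s \<and> s' \<and> t = t' \<or> p = p' \<and> s = s' \<and> \<not> t \<and> t' \<or>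
     p = Suc p' \<and> s = s' \<and> t \<and> t'"
| "arc (L p s t) (M p' q' s' t') \<longleftrightarrow> False"
| "arc (R p s t) (M p' q' s' t') \<longleftrightarrow> False"
| "arc (R p s t) (L p' s' t') \<longleftrightarrow> False"

text \<open>Meant for \<open>i < j\<close>. The ranges leave out exactly the polygon sides: the fan
  at \<open>a + 5\<close> starts at 2 because \<open>{1, a + 5}\<close> is a side, and the fan at
  \<open>a + 1\<close> stops before \<open>a\<close> because \<open>{a, a + 1}\<close> is
  one.\<close>

fun seg :: "nat \<Rightarrow> cell \<Rightarrow> nat \<Rightarrow> nat \<Rightarrow> bool" where
  "seg a (M p q s t) i j \<longleftrightarrow>
     2 \<le> i \<and> i \<le> p + 1 \<and> j = a + 5 \<or>
     p + 1 \<le> i \<and> i \<le> p + q + 1 \<and> j = a + 3 \<or>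
     p + q + 1 \<le> i \<and> i < a \<and> j = a + 1 \<or>
     s \<and> i = a + 1 \<and> j = a + 3 \<or> \<not> s \<and> i = p + q + 1 \<and> j = a + 2 \<or>
     t \<and> i = a + 3 \<and> j = a + 5 \<or> \<not> t \<and> i = p + 1 \<and> j = a + 4"
| "seg a (L p s t) i j \<longleftrightarrow>
     2 \<le> i \<and> i \<le> p + 1 \<and> j = a + 5 \<or>
     p + 1 \<le> i \<and> i < a \<and> j = a + 1 \<or>
     i = a + 1 \<and> j = a + 4 \<or>
     s \<and> i = a + 1 \<and> j = a + 3 \<or> \<not> s \<and> i = a + 2 \<and> j = a + 4 \<or>
     t \<and> i = a + 1 \<and> j = a + 5 \<or> \<not> t \<and> i = p + 1 \<and> j = a + 4"
| "seg a (R p s t) i j \<longleftrightarrow>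
     2 \<le> i \<and> i \<le> p + 1 \<and> j = a + 5 \<or>
     p + 1 \<le> i \<and> i < a \<and> j = a + 1 \<or>
     i = a + 2 \<and> j = a + 5 \<or>
     s \<and> i = a + 3 \<and> j = a + 5 \<or> \<not> s \<and> i = a + 2 \<and> j = a + 4 \<or>
     t \<and> i = a + 1 \<and> j = a + 5 \<or> \<not> t \<and> i = p + 1 \<and> j = a + 2"

definition tri :: "nat \<Rightarrow> cell \<Rightarrow> nat set set" where
  "tri a c = chords (seg a c)"

section \<open>Cells describe colorful triangulations\<close>

lemma diagonal_cases:
  fixes i j a :: nat
  assumes ij: "i + 2 \<le> j" "j \<le> a + 5"
  obtains "j \<le> a" | "i \<le> a" "j = a + 1" | "i \<le> a" "j = a + 2" | "i \<le> a" "j = a + 3"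
    | "i \<le> a" "j = a + 4" | "i \<le> a" "j = a + 5" | "i = a + 1" "j = a + 3" | "i = a + 1" "j = a + 4"
    | "i = a + 1" "j = a + 5" | "i = a + 2" "j = a + 4" | "i = a + 2" "j = a + 5" | "i = a + 3" "j = a + 5"
proof -
  have "j \<le> a \<or> j = a + 1 \<or> j = a + 2 \<or> j = a + 3 \<or> j = a + 4 \<or> j = a + 5"
    using ij by linarith
  moreover have "i \<le> a \<or> i = a + 1 \<or> i = a + 2 \<or> i = a + 3"
    using ij by linarith
  ultimately show thesis using ij that by (elim disjE) simp_all
qed

lemma triangulation_tri:
  assumes "valid a c"
  shows "triangulation (a + 5) (tri a c)"
  unfolding tri_def
proof (rule triangulation_chordsI)
  show "1 \<le> i \<and> i + 2 \<le> j \<and> j \<le> a + 5 \<and> \<not> (i = 1 \<and> j = a + 5)" if "i < j" "seg a c i j" for i j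
    using that assms by (cases c) (auto split: if_splits)
  show False if "seg a c i j" "seg a c k l" "i < k" "k < j" "j < l" for i j k l
    using that assms by (cases c) (auto split: if_splits)
  fix i j
  assume ij: "1 \<le> i" "i + 2 \<le> j" "j \<le> a + 5" "\<not> (i = 1 \<and> j = a + 5)"
    and nc: "\<And>k l. k < l \<Longrightarrow> seg a c k l \<Longrightarrow> \<not> (i < k \<and> k < j \<and> j < l) \<and> \<not> (k < i \<and> i < l \<and> l < j)"
  \<comment> \<open>For a segment with \<open>j \<le> a\<close>: the point \<open>i + 1\<close> lies
    strictly between its ends and has a diagonal to some blue point, which crosses it.\<close>
  note fan = nc[of "i + 1" "a + 1"] nc[of "i + 1" "a + 3"] nc[of "i + 1" "a + 5"]
  show "seg a c i j"
  proof (cases c)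
    case (M p q s t)
    have pq: "p + q < a" using assms M by simp
    \<comment> \<open>The chords tested here are the extreme edges of the fans and the two free
      diagonals. Every absent diagonal with \<open>j > a\<close> crosses one of them. The cases
      \<open>L\<close> and \<open>R\<close> follow the same pattern, with the diagonal of the
      contracted hexagon as a further test chord.\<close>
    have c1: "0 < p \<longrightarrow> \<not> (i < p + 1 \<and> p + 1 < j \<and> j < a + 5) \<and> \<not> (p + 1 < i \<and> i < a + 5 \<and> a + 5 < j)"
      using nc[of "p + 1" "a + 5"] pq by (auto simp: M)
    have c2: "\<not> (i < p + 1 \<and> p + 1 < j \<and> j < a + 3) \<and> \<not> (p + 1 < i \<and> i < a + 3 \<and> a + 3 < j)"
      using nc[of "p + 1" "a + 3"] pq by (auto simp: M)
    have c3: "\<not> (i < p + q + 1 \<and> p + q + 1 < j \<and> j < a + 3) \<and> \<not> (p + q + 1 < i \<and> i < a + 3 \<and> a + 3 < j)"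
      using nc[of "p + q + 1" "a + 3"] pq by (auto simp: M)
    have c4: "p + q + 1 < a \<longrightarrow> \<not> (i < p + q + 1 \<and> p + q + 1 < j \<and> j < a + 1) \<and> \<not> (p + q + 1 < i \<and> i < a + 1 \<and> a + 1 < j)"
      using nc[of "p + q + 1" "a + 1"] pq by (auto simp: M)
    have s: "if s then \<not> (i < a + 1 \<and> a + 1 < j \<and> j < a + 3) \<and> \<not> (a + 1 < i \<and> i < a + 3 \<and> a + 3 < j)
      else \<not> (i < p + q + 1 \<and> p + q + 1 < j \<and> j < a + 2) \<and> \<not> (p + q + 1 < i \<and> i < a + 2 \<and> a + 2 < j)"
      using nc[of "a + 1" "a + 3"] nc[of "p + q + 1" "a + 2"] pq unfolding M by auto
    have t: "if t then \<not> (i < a + 3 \<and> a + 3 < j \<and> j < a + 5) \<and> \<not> (a + 3 < i \<and> i < a + 5 \<and> a + 5 < j)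
      else \<not> (i < p + 1 \<and> p + 1 < j \<and> j < a + 4) \<and> \<not> (p + 1 < i \<and> i < a + 4 \<and> a + 4 < j)"
      using nc[of "a + 3" "a + 5"] nc[of "p + 1" "a + 4"] pq unfolding M by auto
    from ij(2,3) show ?thesis
    proof (cases rule: diagonal_cases)
      case 1
      then show ?thesis using ij pq fan unfolding M by force
    next
      case 2
      then show ?thesis using ij pq c3 by (auto simp: M split: if_splits)
    next
      case 3
      then show ?thesis using ij pq c3 c4 s by (auto simp: M split: if_splits)
    next
      case 4
      then show ?thesis using ij pq c1 c4 by (auto simp: M split: if_splits)
    next
      case 5
      then show ?thesis using ij pq c1 c2 t by (auto simp: M split: if_splits)
    next
      case 6
      then show ?thesis using ij pq c2 by (auto simp: M split: if_splits)
    next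
      case 7
      then show ?thesis using ij pq s by (auto simp: M split: if_splits)
    next
      case 8
      then show ?thesis using ij pq c3 by (auto simp: M split: if_splits)
    next
      case 9
      then show ?thesis using ij pq c3 by (auto simp: M split: if_splits)
    next
      case 10
      then show ?thesis using ij pq c3 by (auto simp: M split: if_splits)
    next
      case 11
      then show ?thesis using ij pq c3 by (auto simp: M split: if_splits)
    next
      case 12
      then show ?thesis using ij pq t by (auto simp: M split: if_splits)
    qed
  next
    case (L p s t)
    have pq: "p < a" using assms L by simp
    have c1: "0 < p \<longrightarrow> \<not> (i < p + 1 \<and> p + 1 < j \<and> j < a + 5) \<and> \<not> (p + 1 < i \<and> i < a + 5 \<and> a + 5 < j)"
      using nc[of "p + 1" "a + 5"] pq by (auto simp: L)
    have c2: "p + 1 < a \<longrightarrow> \<not> (i < p + 1 \<and> p + 1 < j \<and> j < a + 1) \<and> \<not> (p + 1 < i \<and> i < a + 1 \<and> a + 1 < j)"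
      using nc[of "p + 1" "a + 1"] pq by (auto simp: L)
    have c3: "\<not> (i < a + 1 \<and> a + 1 < j \<and> j < a + 4) \<and> \<not> (a + 1 < i \<and> i < a + 4 \<and> a + 4 < j)"
      using nc[of "a + 1" "a + 4"] pq by (auto simp: L)
    have s: "if s then \<not> (i < a + 1 \<and> a + 1 < j \<and> j < a + 3) \<and> \<not> (a + 1 < i \<and> i < a + 3 \<and> a + 3 < j)
      else \<not> (i < a + 2 \<and> a + 2 < j \<and> j < a + 4) \<and> \<not> (a + 2 < i \<and> i < a + 4 \<and> a + 4 < j)"
      using nc[of "a + 1" "a + 3"] nc[of "a + 2" "a + 4"] pq unfolding L by auto
    have t: "if t then \<not> (i < a + 1 \<and> a + 1 < j \<and> j < a + 5) \<and> \<not> (a + 1 < i \<and> i < a + 5 \<and> a + 5 < j)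
      else \<not> (i < p + 1 \<and> p + 1 < j \<and> j < a + 4) \<and> \<not> (p + 1 < i \<and> i < a + 4 \<and> a + 4 < j)"
      using nc[of "a + 1" "a + 5"] nc[of "p + 1" "a + 4"] pq unfolding L by auto
    from ij(2,3) show ?thesis
    proof (cases rule: diagonal_cases)
      case 1
      then show ?thesis using ij pq fan unfolding L by force
    next
      case 2
      then show ?thesis using ij pq c1 by (auto simp: L split: if_splits)
    next
      case 3
      then show ?thesis using ij pq c3 by (auto simp: L split: if_splits)
    next
      case 4
      then show ?thesis using ij pq c3 by (auto simp: L split: if_splits)
    next
      case 5
      then show ?thesis using ij pq c1 c2 t by (auto simp: L split: if_splits)
    next
      case 6
      then show ?thesis using ij pq c2 by (auto simp: L split: if_splits)
    next
      case 7
      then show ?thesis using ij pq s by (auto simp: L split: if_splits)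
    next
      case 8
      then show ?thesis using ij pq  by (auto simp: L split: if_splits)
    next
      case 9
      then show ?thesis using ij pq t by (auto simp: L split: if_splits)
    next
      case 10
      then show ?thesis using ij pq s by (auto simp: L split: if_splits)
    next
      case 11
      then show ?thesis using ij pq c3 by (auto simp: L split: if_splits)
    next
      case 12
      then show ?thesis using ij pq c3 by (auto simp: L split: if_splits)
    qed
  next
    case (R p s t)
    have pq: "p < a" using assms R by simp
    have c1: "0 < p \<longrightarrow> \<not> (i < p + 1 \<and> p + 1 < j \<and> j < a + 5) \<and> \<not> (p + 1 < i \<and> i < a + 5 \<and> a + 5 < j)"
      using nc[of "p + 1" "a + 5"] pq by (auto simp: R)
    have c2: "p + 1 < a \<longrightarrow> \<not> (i < p + 1 \<and> p + 1 < j \<and> j < a + 1) \<and> \<not> (p + 1 < i \<and> i < a + 1 \<and> a + 1 < j)"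
      using nc[of "p + 1" "a + 1"] pq by (auto simp: R)
    have c3: "\<not> (i < a + 2 \<and> a + 2 < j \<and> j < a + 5) \<and> \<not> (a + 2 < i \<and> i < a + 5 \<and> a + 5 < j)"
      using nc[of "a + 2" "a + 5"] pq by (auto simp: R)
    have s: "if s then \<not> (i < a + 3 \<and> a + 3 < j \<and> j < a + 5) \<and> \<not> (a + 3 < i \<and> i < a + 5 \<and> a + 5 < j)
      else \<not> (i < a + 2 \<and> a + 2 < j \<and> j < a + 4) \<and> \<not> (a + 2 < i \<and> i < a + 4 \<and> a + 4 < j)"
      using nc[of "a + 3" "a + 5"] nc[of "a + 2" "a + 4"] pq unfolding R by auto
    have t: "if t then \<not> (i < a + 1 \<and> a + 1 < j \<and> j < a + 5) \<and> \<not> (a + 1 < i \<and> i < a + 5 \<and> a + 5 < j)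
      else \<not> (i < p + 1 \<and> p + 1 < j \<and> j < a + 2) \<and> \<not> (p + 1 < i \<and> i < a + 2 \<and> a + 2 < j)"
      using nc[of "a + 1" "a + 5"] nc[of "p + 1" "a + 2"] pq unfolding R by auto
    from ij(2,3) show ?thesis
    proof (cases rule: diagonal_cases)
      case 1
      then show ?thesis using ij pq fan unfolding R by force
    next
      case 2
      then show ?thesis using ij pq c1 by (auto simp: R split: if_splits)
    next
      case 3
      then show ?thesis using ij pq c1 c2 t by (auto simp: R split: if_splits)
    next
      case 4
      then show ?thesis using ij pq c3 by (auto simp: R split: if_splits)
    next
      case 5
      then show ?thesis using ij pq c3 by (auto simp: R split: if_splits)
    next
      case 6
      then show ?thesis using ij pq c2 by (auto simp: R split: if_splits)
    next
      case 7
      then show ?thesis using ij pq c3 by (auto simp: R split: if_splits)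
    next
      case 8
      then show ?thesis using ij pq c3 by (auto simp: R split: if_splits)
    next
      case 9
      then show ?thesis using ij pq t by (auto simp: R split: if_splits)
    next
      case 10
      then show ?thesis using ij pq s by (auto simp: R split: if_splits)
    next
      case 11
      then show ?thesis using ij pq  by (auto simp: R split: if_splits)
    next
      case 12
      then show ?thesis using ij pq s by (auto simp: R split: if_splits)
    qed
  qed
qed

text \<open>Every kind of cell lacks one edge of the blue triangle: \<open>M\<close> lacks
  \<open>{a + 1, a + 5}\<close>, \<open>L\<close> lacks \<open>{a + 3, a + 5}\<close>,
  \<open>R\<close> lacks \<open>{a + 1, a + 3}\<close>. A red triangle fails because the points up
  to \<open>a\<close> are joined to each other by sides only, \<open>a + 2\<close> and
  \<open>a + 4\<close> have at most one neighbor each among them, and no cell contains all edges of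
  a triangle \<open>i\<close>, \<open>a + 2\<close>, \<open>a + 4\<close>.\<close>

lemma colorful_tri:
  assumes "valid a c"
  shows "colorful [a, 1, 1, 1, 1, 1] (tri a c)"
  unfolding colorful_iff[OF triangulation_tri[OF assms]]
proof (intro allI impI)
  fix i j k
  assume ijk: "i < j" "j < k" and
    e: "{i, j} \<in> sides (a + 5) \<union> tri a c" "{j, k} \<in> sides (a + 5) \<union> tri a c" "{i, k} \<in> sides (a + 5) \<union> tri a c"
  have e': "(1 \<le> x \<and> y \<le> a + 5 \<and> (y = Suc x \<or> x = 1 \<and> y = a + 5)) \<or> seg a c x y"
    if "{x, y} \<in> sides (a + 5) \<union> tri a c" "x < y" for x y
    using that by (auto simp: mem_sides tri_def mem_chords)
  show "\<not> ({i, j, k} \<subseteq> {a + 1, a + 3, a + 5} \<or> {i, j, k} \<inter> {a + 1, a + 3, a + 5} = {})"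
  proof
    assume mono: "{i, j, k} \<subseteq> {a + 1, a + 3, a + 5} \<or> {i, j, k} \<inter> {a + 1, a + 3, a + 5} = {}"
    have "0 < a" using assms by (cases c) auto
    have "k \<le> a + 5" using e'[OF e(3)] assms ijk by (cases c) (auto split: if_splits)
    have E: "(1 \<le> i \<and> j \<le> a + 5 \<and> (j = Suc i \<or> i = 1 \<and> j = a + 5)) \<or> seg a c i j"
       "(1 \<le> j \<and> k \<le> a + 5 \<and> (k = Suc j \<or> j = 1 \<and> k = a + 5)) \<or> seg a c j k"
       "(1 \<le> i \<and> k \<le> a + 5 \<and> (k = Suc i \<or> i = 1 \<and> k = a + 5)) \<or> seg a c i k"
      using e'[OF e(1)] e'[OF e(2)] e'[OF e(3)] ijk by auto
    have no: "\<not> seg a c x y" if "y \<le> a" for x y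
      using that by (cases c) (auto split: if_splits)
    from mono show False
    proof
      assume "{i, j, k} \<subseteq> {a + 1, a + 3, a + 5}"
      then have *: "i = a + 1" "j = a + 3" "k = a + 5" using ijk by auto
      have seg: "seg a c (a + 1) (a + 3)" "seg a c (a + 3) (a + 5)" "seg a c (a + 1) (a + 5)"
        using E \<open>0 < a\<close> unfolding * by simp_all
      show ?thesis
      proof (cases c)
        case (M p q s t)
        then show ?thesis using assms seg(3) by (auto split: if_splits)
      next
        case (L p s t)
        then show ?thesis using assms seg(2) by (auto split: if_splits)
      next
        case (R p s t)
        then show ?thesis using assms seg(1) by (auto split: if_splits)
      qed
    next
      assume "{i, j, k} \<inter> {a + 1, a + 3, a + 5} = {}"
      then have "k \<noteq> a + 1" "k \<noteq> a + 3" "k \<noteq> a + 5" "j \<noteq> a + 1" "j \<noteq> a + 3" "i \<noteq> a + 1"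
        by simp_all
      then have "k \<le> a \<or> k = a + 2 \<or> k = a + 4" "j \<le> a \<or> j = a + 2" "i \<le> a \<or> a + 2 \<le> i"
        using ijk \<open>k \<le> a + 5\<close> by linarith+
      then consider "k \<le> a" | "j \<le> a" "k = a + 2" | "j \<le> a" "k = a + 4" | "i \<le> a" "j = a + 2" "k = a + 4"
        using ijk by (elim disjE) simp_all
      then show False
      proof cases
        case 1
        then have "j = Suc i" "k = Suc j" "k = Suc i"
          using E ijk no[of j i] no[of k j] no[of k i] by simp_all
        then show ?thesis by simp
      next
        case 2
        then have "seg a c j (a + 2)" "seg a c i (a + 2)"
          using E ijk by simp_all
        moreover have "x = y" if "seg a c x (a + 2)" "seg a c y (a + 2)" "x \<le> a" "y \<le> a" for x y
          using that by (cases c) auto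
        ultimately show ?thesis using ijk 2(1) by fastforce
      next
        case 3
        then have "seg a c j (a + 4)" "seg a c i (a + 4)"
          using E ijk by simp_all
        moreover have "x = y" if "seg a c x (a + 4)" "seg a c y (a + 4)" "x \<le> a" "y \<le> a" for x y
          using that by (cases c) auto
        ultimately show ?thesis using ijk 3(1) by fastforce
      next
        case 4
        then have "seg a c i (a + 2)" "seg a c i (a + 4)" "seg a c (a + 2) (a + 4)"
          using E ijk by simp_all
        then show ?thesis using 4(1) by (cases c) auto
      qed
    qed
  qed
qed

text \<open>Both sets are maximal and noncrossing, so one inclusion gives equality. To identify a
  triangulation it is enough to find the edges of the cell in it.\<close>

lemma tri_subset_imp_eq:
  assumes "valid a c" "triangulation (a + 5) T" "\<And>x y. x < y \<Longrightarrow> seg a c x y \<Longrightarrow> {x, y} \<in> sides (a + 5) \<union> T"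
  shows "T = tri a c"
proof -
  have "tri a c \<subseteq> T"
  proof
    fix d assume d: "d \<in> tri a c"
    then obtain x y where "x < y" "d = {x, y}" "seg a c x y" by (auto simp: tri_def chords_def)
    then have "d \<in> sides (a + 5) \<union> T" using assms(3) by blast
    moreover have "d \<notin> sides (a + 5)"
      using d triangulation_tri[OF assms(1)] by (auto simp: triangulation_def diagonals_def)
    ultimately show "d \<in> T" by blast
  qed
  moreover have "T \<subseteq> diagonals (a + 5)" "noncrossing T" using assms(2) by (auto simp: triangulation_def)
  ultimately show ?thesis using triangulation_tri[OF assms(1)] unfolding triangulation_def by blast
qed

section \<open>Every colorful triangulation comes from a cell\<close>

context
  fixes a :: nat and T :: "nat set set" and e :: "nat \<Rightarrow> nat \<Rightarrow> bool"
  assumes a: "1 \<le> a" and T: "triangulation (a + 5) T" and col: "colorful [a, 1, 1, 1, 1, 1] T"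
  defines "e \<equiv> \<lambda>x y. {x, y} \<in> sides (a + 5) \<union> T"
begin

lemma tri_eqI: "valid a c \<Longrightarrow> (\<And>x y. seg a c x y \<Longrightarrow> e x y) \<Longrightarrow> T = tri a c"
  using tri_subset_imp_eq[OF _ T] unfolding e_def by blast

lemma edge_side: "1 \<le> x \<Longrightarrow> x < a + 5 \<Longrightarrow> e x (Suc x)"
  by (simp add: e_def mem_sides)

lemma edge_apex:
  assumes "e x y" "Suc x < y"
  obtains z where "x < z" "z < y" "e x z" "e z y"
  using triangulation_apex[OF _ T, of x y] assms unfolding e_def by auto

lemma not_red:
  assumes "e x y" "e y z" "e x z" "x < y" "y < z" "y \<le> a" "z \<le> a \<or> z = a + 2 \<or> z = a + 4"
  shows False
  using col[unfolded colorful_iff[OF T], rule_format, of x y z] assms unfolding e_def by auto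

lemma not_red':
  assumes "e x (a + 2)" "e (a + 2) (a + 4)" "e x (a + 4)" "x \<le> a"
  shows False
  using col[unfolded colorful_iff[OF T], rule_format, of x "a + 2" "a + 4"] assms unfolding e_def by auto

lemma not_blue:
  assumes "e (a + 1) (a + 3)" "e (a + 3) (a + 5)" "e (a + 1) (a + 5)"
  shows False
  using col[unfolded colorful_iff[OF T], rule_format, of "a + 1" "a + 3" "a + 5"] assms unfolding e_def by auto

text \<open>Move from \<open>x\<close> to \<open>Suc x\<close> through the triangle below
  \<open>{x, B}\<close>. Its apex cannot pass \<open>j\<close> without crossing
  \<open>{j, B}\<close>, and if it were beyond \<open>Suc x\<close>, the triangle below its red edge
  would have three red corners.\<close>

lemma edge_fan:
  assumes "e i B" "e j B" "j \<le> a" "a < B" "i \<le> x" "x \<le> j"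
  shows "e x B"
  using assms(5,6)
proof (induction x rule: dec_induct)
  case base
  then show ?case using assms by simp
next
  case (step x)
  then have ex: "e x B" by simp
  obtain z where z: "x < z" "z < B" "e x z" "e z B"
    using edge_apex[OF ex] step assms by auto
  have "z \<le> j"
    using edges_noncrossing[OF _ T, of x z j B] z assms step unfolding e_def by fastforce
  have "z = Suc x"
  proof (rule ccontr)
    assume "z \<noteq> Suc x"
    then obtain y where "x < y" "y < z" "e x y" "e y z" using edge_apex[OF z(3)] z by auto
    then show False using not_red[of x y z] z \<open>z \<le> j\<close> assms by auto
  qed
  then show ?case using z by simp
qed

lemma apex_red_blue:
  assumes "e x (a + 2)" "1 \<le> x" "x \<le> a"
  shows "e x (a + 1)"
proof -
  obtain z where z: "x < z" "z < a + 2" "e x z" "e z (a + 2)" using edge_apex[OF assms(1)] assms by auto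
  then have "\<not> z \<le> a" using not_red[of x z "a + 2"] assms by auto
  then have "z = a + 1" using z by simp
  then show ?thesis using z by simp
qed

lemma fan_B1: "e x (a + 1) \<Longrightarrow> x \<le> y \<Longrightarrow> y \<le> a \<Longrightarrow> e y (a + 1)"
  using edge_fan[of x "a + 1" a y] edge_side[of a] a by simp

text \<open>The last neighbor of \<open>a + 3\<close> in the red block is \<open>p + q + 1\<close>,
  which fixes \<open>q\<close>. By its maximality the triangle below that edge has apex
  \<open>a + 1\<close> or \<open>a + 2\<close>, which fixes \<open>s\<close>.\<close>

lemma tri_M:
  assumes "e (Suc p) (a + 3)" "p < a" and F3: "\<And>x. 1 \<le> x \<Longrightarrow> x \<le> p + 1 \<Longrightarrow> e x (a + 5)"
    and t: "if t then e (a + 3) (a + 5) else e (Suc p) (a + 4)"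
  shows "\<exists>c. valid a c \<and> T = tri a c"
proof -
  define Q where "Q = {x. Suc p \<le> x \<and> x \<le> a \<and> e x (a + 3)}"
  have "finite Q" by (rule finite_subset[of _ "{..a}"]) (auto simp: Q_def)
  moreover have "Suc p \<in> Q" using assms by (auto simp: Q_def)
  ultimately have Max: "Max Q \<in> Q" "\<And>x. x \<in> Q \<Longrightarrow> x \<le> Max Q" by (auto intro: Max_in)
  define q where "q = Max Q - Suc p"
  have q: "Max Q = p + q + 1" "p + q < a" "e (p + q + 1) (a + 3)"
    using Max(1) by (auto simp: Q_def q_def)
  have F2: "e x (a + 3)" if "p + 1 \<le> x" "x \<le> p + q + 1" for x
    using edge_fan[of "p + 1" "a + 3" "p + q + 1" x] assms(1) q that by simp
  obtain z where z: "p + q + 1 < z" "z < a + 3" "e (p + q + 1) z" "e z (a + 3)"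
    using edge_apex[OF q(3)] q(2) by auto
  have "z \<in> Q" if "z \<le> a" using that z by (simp add: Q_def)
  then have "\<not> z \<le> a" using Max(2)[of z] z(1) q(1) by auto
  then consider (s) "z = a + 1" | (ns) "z = a + 2" using z by linarith
  then have "\<exists>s. e (p + q + 1) (a + 1) \<and> (if s then e (a + 1) (a + 3) else e (p + q + 1) (a + 2))"
  proof cases
    case s
    then show ?thesis using z by (intro exI[of _ True]) simp
  next
    case ns
    then show ?thesis using z apex_red_blue[of "p + q + 1"] q by (intro exI[of _ False]) simp
  qed
  then obtain s where s: "e (p + q + 1) (a + 1)" "if s then e (a + 1) (a + 3) else e (p + q + 1) (a + 2)"
    by blast
  have "valid a (M p q s t)" using q by simp
  moreover from this have "T = tri a (M p q s t)"
  proof (rule tri_eqI)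
    fix x y assume "seg a (M p q s t) x y"
    then show "e x y"
      using F2[of x] F3[of x] fan_B1[OF s(1), of x] s(2) t
      by (auto split: if_splits)
  qed
  ultimately show ?thesis by blast
qed

lemma tri_L:
  assumes "e (Suc p) (a + 1)" "p < a" and F3: "\<And>x. 1 \<le> x \<Longrightarrow> x \<le> p + 1 \<Longrightarrow> e x (a + 5)"
    and "e (a + 1) (a + 4)" and t: "if t then e (a + 1) (a + 5) else e (Suc p) (a + 4)"
  shows "\<exists>c. valid a c \<and> T = tri a c"
proof -
  obtain z where z: "a + 1 < z" "z < a + 4" "e (a + 1) z" "e z (a + 4)"
    using edge_apex[OF assms(4)] by auto
  then consider "z = a + 2" | "z = a + 3" by linarith
  then have "\<exists>s. if s then e (a + 1) (a + 3) else e (a + 2) (a + 4)"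
  proof cases
    case 1
    then show ?thesis using z by (intro exI[of _ False]) simp
  next
    case 2
    then show ?thesis using z by (intro exI[of _ True]) simp
  qed
  then obtain s where s: "if s then e (a + 1) (a + 3) else e (a + 2) (a + 4)" by blast
  have "valid a (L p s t)" using assms by simp
  moreover from this have "T = tri a (L p s t)"
  proof (rule tri_eqI)
    fix x y assume "seg a (L p s t) x y"
    then show "e x y"
      using F3[of x] fan_B1[OF assms(1), of x] assms(4) s t
      by (auto split: if_splits)
  qed
  ultimately show ?thesis by blast
qed

lemma tri_R:
  assumes "e (Suc p) (a + 1)" "p < a" and F3: "\<And>x. 1 \<le> x \<Longrightarrow> x \<le> p + 1 \<Longrightarrow> e x (a + 5)"
    and "e (a + 2) (a + 5)" and t: "if t then e (a + 1) (a + 5) else e (Suc p) (a + 2)"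
  shows "\<exists>c. valid a c \<and> T = tri a c"
proof -
  obtain z where z: "a + 2 < z" "z < a + 5" "e (a + 2) z" "e z (a + 5)"
    using edge_apex[OF assms(4)] by auto
  then consider "z = a + 3" | "z = a + 4" by linarith
  then have "\<exists>s. if s then e (a + 3) (a + 5) else e (a + 2) (a + 4)"
  proof cases
    case 1
    then show ?thesis using z by (intro exI[of _ True]) simp
  next
    case 2
    then show ?thesis using z by (intro exI[of _ False]) simp
  qed
  then obtain s where s: "if s then e (a + 3) (a + 5) else e (a + 2) (a + 4)" by blast
  have "valid a (R p s t)" using assms by simp
  moreover from this have "T = tri a (R p s t)"
  proof (rule tri_eqI)
    fix x y assume "seg a (R p s t) x y"
    then show "e x y"
      using F3[of x] fan_B1[OF assms(1), of x] assms(4) s t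
      by (auto split: if_splits)
  qed
  ultimately show ?thesis by blast
qed

text \<open>Let \<open>Suc p\<close> be the last red point of the block joined to
  \<open>a + 5\<close>. By its maximality the triangle below \<open>{Suc p, a + 5}\<close> has its
  apex \<open>z\<close> beyond \<open>a\<close>. For \<open>z = a + 2\<close> and
  \<open>z = a + 3\<close> this already gives the kind of cell and the bit \<open>t\<close>; for
  \<open>z = a + 1\<close> and \<open>z = a + 4\<close> the neighboring triangle decides, where a
  monochromatic triangle is excluded.\<close>

lemma colorful_imp_tri: "\<exists>c. valid a c \<and> T = tri a c"
proof -
  define P where "P = {x. 1 \<le> x \<and> x \<le> a \<and> e x (a + 5)}"
  have e1: "e 1 (a + 5)" by (simp add: e_def mem_sides)
  have "finite P" by (rule finite_subset[of _ "{..a}"]) (auto simp: P_def)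
  moreover have "1 \<in> P" using a e1 by (auto simp: P_def)
  ultimately have Max: "Max P \<in> P" "\<And>x. x \<in> P \<Longrightarrow> x \<le> Max P" by (auto intro: Max_in)
  define p where "p = Max P - 1"
  have p: "Max P = Suc p" "p < a" "e (Suc p) (a + 5)" using Max(1) by (auto simp: P_def p_def)
  have F3: "e x (a + 5)" if "1 \<le> x" "x \<le> p + 1" for x
    using edge_fan[of 1 "a + 5" "Suc p" x] e1 p that by simp
  obtain z where z: "Suc p < z" "z < a + 5" "e (Suc p) z" "e z (a + 5)"
    using edge_apex[OF p(3)] p(2) by auto
  have "z \<in> P" if "z \<le> a" using that z by (simp add: P_def)
  then have "\<not> z \<le> a" using Max(2)[of z] z(1) p(1) by auto
  then consider "z = a + 1" | "z = a + 2" | "z = a + 3" | "z = a + 4" using z by linarith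
  then show ?thesis
  proof cases
    case 1
    then obtain y where y: "a + 1 < y" "y < a + 5" "e (a + 1) y" "e y (a + 5)"
      using edge_apex[of "a + 1" "a + 5"] z by auto
    have "y \<noteq> a + 3" using not_blue y z 1 by auto
    then consider "y = a + 2" | "y = a + 4" using y by linarith
    then show ?thesis
    proof cases
      case 1
      then show ?thesis using tri_R[OF _ p(2) F3, of True] y z \<open>z = a + 1\<close> by simp
    next
      case 2
      then show ?thesis using tri_L[OF _ p(2) F3, of True] y z \<open>z = a + 1\<close> by simp
    qed
  next
    case 2
    then show ?thesis using tri_R[OF _ p(2) F3, of False] apex_red_blue[of "Suc p"] z p by simp
  next
    case 3
    then show ?thesis using tri_M[OF _ p(2) F3, of True] z by simp
  next
    case 4
    then have z4: "e (Suc p) (a + 4)" using z by simp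
    obtain y where y: "Suc p < y" "y < a + 4" "e (Suc p) y" "e y (a + 4)"
      using edge_apex[OF z4] p(2) by auto
    have "\<not> y \<le> a" using not_red[of "Suc p" y "a + 4"] y z4 by auto
    moreover have "y \<noteq> a + 2" using not_red'[of "Suc p"] y z4 p by auto
    ultimately consider "y = a + 1" | "y = a + 3" using y by linarith
    then show ?thesis
    proof cases
      case 1
      then show ?thesis using tri_L[OF _ p(2) F3, of False] y z4 by simp
    next
      case 2
      then show ?thesis using tri_M[OF _ p(2) F3, of False] y z4 by simp
    qed
  qed
qed

end

section \<open>Cells as nodes of the flip graph\<close>

lemma seg_eq_if_tri_eq: "tri a c = tri a c' \<Longrightarrow> x < y \<Longrightarrow> seg a c x y = seg a c' x y"
  by (metis mem_chords tri_def)

text \<open>The segment \<open>{a + 1, a + 4}\<close> occurs only in \<open>L\<close> cells and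
  \<open>{a + 2, a + 5}\<close> only in \<open>R\<close> cells, so the kind can be read off. The
  bits are blue segments. The counts are lengths of fans, compared only on \<open>2..a\<close>
  because \<open>{1, a + 5}\<close> is a side; the bound by \<open>a\<close> makes this range
  sufficient.\<close>

lemma inj_on_tri: "inj_on (tri a) {c. valid a c}"
proof (rule inj_onI)
  have pp: "p = p'" if "p < a" "p' < a" "\<And>x. 2 \<le> x \<Longrightarrow> x \<le> a \<Longrightarrow> x \<le> p + 1 \<longleftrightarrow> x \<le> p' + 1" for p p'
  proof (rule ccontr)
    assume "p \<noteq> p'"
    then consider "p < p'" | "p' < p" by linarith
    then show False using that(3)[of "p + 1"] that(3)[of "p' + 1"] that(1,2) by cases auto
  qed
  fix c c' assume "c \<in> {c. valid a c}" "c' \<in> {c. valid a c}" and eq: "tri a c = tri a c'"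
  then have c: "valid a c" "valid a c'" by auto
  note seg = seg_eq_if_tri_eq[OF eq]
  note bits = seg[of "a + 1" "a + 4"] seg[of "a + 2" "a + 5"] seg[of "a + 1" "a + 3"] seg[of "a + 3" "a + 5"] seg[of "a + 1" "a + 5"]
  show "c = c'"
  proof (cases c)
    case (M p q s t)
    then obtain p' q' s' t' where M': "c' = M p' q' s' t'" using c bits(1,2) by (cases c') auto
    have pq: "p + q < a" "p' + q' < a" using c M M' by auto
    have "s = s'" "t = t'" using bits(3,4) pq unfolding M M' by auto
    have "p = p'"
    proof (rule pp)
      show "x \<le> p + 1 \<longleftrightarrow> x \<le> p' + 1" if "2 \<le> x" "x \<le> a" for x
        using seg[of x "a + 5"] that unfolding M M' by simp
    qed (use pq in auto)
    have "p + q = p + q'"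
    proof (rule pp)
      show "x \<le> p + q + 1 \<longleftrightarrow> x \<le> p + q' + 1" if "2 \<le> x" "x \<le> a" for x
        using seg[of x "a + 3"] that \<open>p = p'\<close> unfolding M M' by auto
    qed (use pq \<open>p = p'\<close> in auto)
    then show ?thesis using M M' \<open>p = p'\<close> \<open>s = s'\<close> \<open>t = t'\<close> by simp
  next
    case (L p s t)
    then obtain p' s' t' where L': "c' = L p' s' t'" using c bits(1,2) by (cases c') auto
    have pq: "p < a" "p' < a" using c L L' by auto
    have "s = s'" "t = t'" using bits(3,5) pq unfolding L L' by auto
    moreover have "p = p'"
    proof (rule pp)
      show "x \<le> p + 1 \<longleftrightarrow> x \<le> p' + 1" if "2 \<le> x" "x \<le> a" for x
        using seg[of x "a + 5"] that unfolding L L' by simp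
    qed (use pq in auto)
    ultimately show ?thesis using L L' by simp
  next
    case (R p s t)
    then obtain p' s' t' where R': "c' = R p' s' t'" using c bits(1,2) by (cases c') auto
    have pq: "p < a" "p' < a" using c R R' by auto
    have "s = s'" "t = t'" using bits(4,5) pq unfolding R R' by auto
    moreover have "p = p'"
    proof (rule pp)
      show "x \<le> p + 1 \<longleftrightarrow> x \<le> p' + 1" if "2 \<le> x" "x \<le> a" for x
        using seg[of x "a + 5"] that unfolding R R' by simp
    qed (use pq in auto)
    ultimately show ?thesis using R R' by simp
  qed
qed

lemma colorful_flip_graph_nodes:
  assumes "1 \<le> a"
  shows "fst (colorful_flip_graph [a, 1, 1, 1, 1, 1]) = tri a ` {c. valid a c}"
proof -
  have "fst (colorful_flip_graph [a, 1, 1, 1, 1, 1]) = {T. triangulation (a + 5) T \<and> colorful [a, 1, 1, 1, 1, 1] T}"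
    unfolding colorful_flip_graph_def sum_list_a11111 induced_subgraph_def associahedron_def by auto
  also have "\<dots> = tri a ` {c. valid a c}"
    using colorful_imp_tri[OF assms] triangulation_tri colorful_tri by fastforce
  finally show ?thesis .
qed

lemma colorful_flip_graph_edges:
  assumes "1 \<le> a" "valid a c" "valid a c'"
  shows "{tri a c, tri a c'} \<in> snd (colorful_flip_graph [a, 1, 1, 1, 1, 1]) \<longleftrightarrow>
    flip (a + 5) (tri a c) (tri a c') \<or> flip (a + 5) (tri a c') (tri a c)"
proof -
  let ?G = "associahedron (a + 5)"
  have "{tri a c, tri a c'} \<in> snd (colorful_flip_graph [a, 1, 1, 1, 1, 1]) \<longleftrightarrow> {tri a c, tri a c'} \<in> snd ?G"
    using assms triangulation_tri[of a] colorful_tri[of a] unfolding colorful_flip_graph_def sum_list_a11111 induced_subgraph_def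
    by (auto simp: associahedron_def)
  also have "\<dots> \<longleftrightarrow> flip (a + 5) (tri a c) (tri a c') \<or> flip (a + 5) (tri a c') (tri a c)"
    using triangulation_tri[OF assms(2)] triangulation_tri[OF assms(3)]
    unfolding associahedron_def snd_conv mem_Collect_eq doubleton_eq_iff by blast
  finally show ?thesis .
qed

section \<open>No Hamilton cycle\<close>

text \<open>A necessary condition for a flip that forgets triangles. Two cells are shown to be
  nonadjacent by naming two different segments that would be lost at once.\<close>

definition exchange_one :: "'a set \<Rightarrow> 'a set \<Rightarrow> bool" where
  "exchange_one S T \<longleftrightarrow> S \<noteq> T \<and> (\<exists>d. S - T \<subseteq> {d}) \<and> (\<exists>d. T - S \<subseteq> {d})"

lemma exchange_one_sym: "exchange_one S T \<longleftrightarrow> exchange_one T S"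
  by (auto simp: exchange_one_def)

lemma flip_imp_exchange_one: "flip N T T' \<Longrightarrow> exchange_one T T'"
proof -
  assume "flip N T T'"
  then obtain i j k l where *: "{i, j} \<in> T" "k \<notin> {i, j}" "T' = insert {k, l} (T - {{i, j}})"
    unfolding flip_def by blast
  then have "{i, j} \<notin> T'" by (auto simp: doubleton_eq_iff)
  then show ?thesis using * unfolding exchange_one_def by blast
qed

lemma exchange_one_seg:
  assumes "exchange_one (tri a c) (tri a c')" "x < y" "z < w"
    "seg a c x y" "\<not> seg a c' x y" "seg a c z w" "\<not> seg a c' z w"
  shows "x = z \<and> y = w"
proof -
  have "{x, y} \<in> tri a c - tri a c'" "{z, w} \<in> tri a c - tri a c'"
    using assms by (simp_all add: tri_def mem_chords)
  then have "{x, y} = {z, w}" using assms(1) unfolding exchange_one_def by blast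
  then show ?thesis using assms(2,3) by (auto simp: doubleton_eq_iff)
qed

text \<open>The larger fan contains an edge that is new, so every other segment of the target is
  already present in the source (\<open>old\<close>). This leaves only the passage of a single
  triangle to the next apex: \<open>q\<close> changes by one and both bits stay.\<close>

lemma exchange_M_M:
  assumes c: "valid a (M p q s t)" "valid a (M p' q' s' t')"
    and ex: "exchange_one (tri a (M p q s t)) (tri a (M p' q' s' t'))"
    and lt: "p < p' \<or> p = p' \<and> q < q'"
  shows "even (q + of_bool s + of_bool t) \<noteq> even (q' + of_bool s' + of_bool t')"
proof -
  let ?c = "M p q s t" and ?c' = "M p' q' s' t'"
  have pq: "p + q < a" "p' + q' < a" using c by auto
  note ex1 = exchange_one_seg[OF ex[unfolded exchange_one_sym[of "tri a ?c"]]]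
  show ?thesis
  proof (cases "p < p'")
    case True
    have f: "seg a ?c' (p' + 1) (a + 5)" "\<not> seg a ?c (p' + 1) (a + 5)" using True pq by auto
    have old: "seg a ?c x y" if "seg a ?c' x y" "x < y" "y \<noteq> a + 5 \<or> x \<noteq> p' + 1" for x y
    proof (rule ccontr)
      assume "\<not> ?thesis"
      with ex1[OF _ that(2) f that(1)] that(3) pq show False by linarith
    qed
    have "p' = Suc p" using old[of "p + 2" "a + 5"] True pq by auto
    have "s = s'"
      using old[of "a + 1" "a + 3"] old[of "p' + q' + 1" "a + 2"] pq by auto
    moreover have "t'" using old[of "p' + 1" "a + 4"] True pq by auto
    moreover from this have "t" using old[of "a + 3" "a + 5"] pq by auto
    \<comment> \<open>The edge to \<open>a + 3\<close> bounds \<open>q\<close> from below, the edge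
      to \<open>a + 1\<close> from above. If \<open>p' + q' + 1 = a\<close>, the latter is a side,
      and the upper bound comes from \<open>p + q < a\<close>.\<close>
    moreover have "q = Suc q'"
      using old[of "p' + q' + 1" "a + 3"] old[of "p' + q' + 1" "a + 1"] pq \<open>p' = Suc p\<close>
      by (cases "p' + q' + 1 < a") auto
    ultimately show ?thesis by auto
  next
    case False
    then have lt: "p = p'" "q < q'" using lt by auto
    have f: "seg a ?c' (p + q' + 1) (a + 3)" "\<not> seg a ?c (p + q' + 1) (a + 3)" using lt pq by auto
    have old: "seg a ?c x y" if "seg a ?c' x y" "x < y" "y \<noteq> a + 3 \<or> x \<noteq> p + q' + 1" for x y
    proof (rule ccontr)
      assume "\<not> ?thesis"
      with ex1[OF _ that(2) f that(1)] that(3) pq lt show False by linarith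
    qed
    have "q' = Suc q" using old[of "p + q + 2" "a + 3"] lt pq by auto
    moreover have "s = s'"
      using old[of "a + 1" "a + 3"] old[of "p' + q' + 1" "a + 2"] lt pq by auto
    moreover have "t = t'"
      using old[of "a + 3" "a + 5"] old[of "p' + 1" "a + 4"] lt pq by auto
    ultimately show ?thesis by auto
  qed
qed

text \<open>Going to an \<open>L\<close> or \<open>R\<close> cell loses
  \<open>{p + 1, a + 3}\<close>, so no second segment may be lost. A further edge at
  \<open>a + 3\<close> would be lost as well, hence \<open>q = 0\<close>. Towards \<open>L\<close>
  this also forces \<open>s\<close> and \<open>\<not> t\<close>, towards \<open>R\<close> the
  reverse; the parity is odd in both cases.\<close>

lemma exchange_M:
  assumes c: "valid a (M p q s t)" "valid a c'"
    and ex: "exchange_one (tri a (M p q s t)) (tri a c')"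
    and ev: "even (q + of_bool s + of_bool t)"
  shows "\<exists>p' q' s' t'. c' = M p' q' s' t' \<and> odd (q' + of_bool s' + of_bool t')"
proof -
  let ?c = "M p q s t"
  have pq: "p + q < a" using c by auto
  note ex1 = exchange_one_seg[OF ex]
  show ?thesis
  proof (cases c')
    case (M p' q' s' t')
    note c' = c(2)[unfolded M] and ex' = ex[unfolded M]
    consider "p < p' \<or> p = p' \<and> q < q'" | "p' < p \<or> p' = p \<and> q' < q" | "p = p'" "q = q'" by linarith
    then have "even (q + of_bool s + of_bool t) \<noteq> even (q' + of_bool s' + of_bool t')"
    proof cases
      case 1
      then show ?thesis using exchange_M_M[OF c(1) c' ex'] by simp
    next
      case 2
      then show ?thesis using exchange_M_M[OF c' c(1) ex'[unfolded exchange_one_sym[of "tri a ?c"]]] by simp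
    next
      case 3
      have "s = s' \<or> t = t'"
      proof (rule ccontr)
        assume "\<not> (s = s' \<or> t = t')"
        then show False
          using ex1[of "if s then a + 1 else p + q + 1" "if s then a + 3 else a + 2"
              "if t then a + 3 else p + 1" "if t then a + 5 else a + 4"] pq 3
          unfolding M by (cases s; cases t) auto
      qed
      moreover have "tri a ?c \<noteq> tri a (M p' q' s' t')" using ex' unfolding exchange_one_def by blast
      then have "\<not> (s = s' \<and> t = t')" using 3 by blast
      ultimately show ?thesis using 3 by auto
    qed
    then show ?thesis using ev M by auto
  next
    case (L p' s' t')
    have "p' < a" using c(2) L by simp
    note ex1' = ex1[of "p + 1" "a + 3", unfolded L]
    have "q = 0" using ex1'[of "p + q + 1" "a + 3"] pq \<open>p' < a\<close> by auto
    moreover have "s" using ex1'[of "p + q + 1" "a + 2"] pq \<open>p' < a\<close> by auto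
    moreover have "\<not> t" using ex1'[of "a + 3" "a + 5"] pq \<open>p' < a\<close> by auto
    ultimately show ?thesis using ev by simp
  next
    case (R p' s' t')
    have "p' < a" using c(2) R by simp
    note ex1' = ex1[of "p + 1" "a + 3", unfolded R]
    have "q = 0" using ex1'[of "p + q + 1" "a + 3"] pq \<open>p' < a\<close> by auto
    moreover have "\<not> s" using ex1'[of "a + 1" "a + 3"] pq \<open>p' < a\<close> by auto
    moreover have "t" using ex1'[of "p + 1" "a + 4"] pq \<open>p' < a\<close> by auto
    ultimately show ?thesis using ev by simp
  qed
qed

text \<open>Along the cycle all successors and all predecessors of nodes in \<open>Y\<close> lie in
  \<open>X\<close>. As the two sets have the same size, the successors fill \<open>X\<close>, and so
  do the predecessors. Thus \<open>X \<union> Y\<close> is closed under taking successors, and the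
  cycle cannot contain \<open>z\<close>.\<close>

lemma hamilton_cycle_obstruction:
  assumes cyc: "hamilton_cycle G vs"
    and XY: "X \<subseteq> fst G" "Y \<subseteq> fst G" "card X = card Y" "Y \<noteq> {}"
    and z: "z \<in> fst G" "z \<notin> X \<union> Y"
    and nb: "\<And>y v. y \<in> Y \<Longrightarrow> {y, v} \<in> snd G \<Longrightarrow> v \<in> X"
  shows False
proof -
  define n where "n = length vs"
  have vs: "3 \<le> n" "distinct vs" "set vs = fst G" "successively (\<lambda>u v. {u, v} \<in> snd G) vs" "{last vs, hd vs} \<in> snd G"
    using cyc by (auto simp: hamilton_cycle_def hamilton_path_def n_def)
  define f where "f i = Suc i mod n" for i
  have f_lt: "f i < n" for i using vs(1) by (simp add: f_def)
  have f_inj: "inj_on f {..<n}"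
    by (rule inj_onI) (auto simp: f_def mod_Suc split: if_splits)
  have edge: "{vs ! i, vs ! f i} \<in> snd G" if "i < n" for i
  proof (cases "Suc i = n")
    case True
    moreover have "vs \<noteq> []" using vs(1) by (auto simp: n_def)
    ultimately have "vs ! i = last vs" "vs ! f i = hd vs"
      by (auto simp: f_def n_def last_conv_nth hd_conv_nth dest: sym)
    then show ?thesis using vs(5) by simp
  next
    case False
    then show ?thesis using that successively_nth[OF vs(4), of i] by (simp add: f_def n_def)
  qed
  define I where "I Z = {i. i < n \<and> vs ! i \<in> Z}" for Z
  have fin: "finite (I Z)" for Z by (simp add: I_def)
  have card_I: "card (I Z) = card Z" if "Z \<subseteq> fst G" for Z
  proof -
    have "bij_betw ((!) vs) (I Z) Z"
    proof (rule bij_betw_imageI)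
      show "inj_on ((!) vs) (I Z)"
        using vs(2) by (auto simp: inj_on_def I_def n_def nth_eq_iff_index_eq)
      have "x \<in> (!) vs ` I Z" if x: "x \<in> Z" for x
      proof -
        have "x \<in> set vs" using x \<open>Z \<subseteq> fst G\<close> vs(3) by blast
        then obtain i where "i < n" "vs ! i = x" unfolding in_set_conv_nth n_def by blast
        then show ?thesis using x unfolding I_def by blast
      qed
      then show "(!) vs ` I Z = Z" unfolding I_def by blast
    qed
    then show ?thesis by (rule bij_betw_same_card)
  qed
  have "f ` I Y \<subseteq> I X"
    using nb edge f_lt by (auto simp: I_def)
  moreover have "card (f ` I Y) = card (I X)"
    using card_I XY inj_on_subset[OF f_inj, of "I Y"] by (simp add: card_image I_def subset_eq)
  ultimately have fY: "f ` I Y = I X" using fin by (simp add: card_subset_eq)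
  define P where "P = {i. i < n \<and> f i \<in> I Y}"
  have "P \<subseteq> I X"
  proof
    fix i assume i: "i \<in> P"
    then have "{vs ! f i, vs ! i} \<in> snd G" using edge[of i] by (simp add: P_def insert_commute)
    then show "i \<in> I X" using nb i by (auto simp: P_def I_def)
  qed
  moreover have "f ` P = I Y"
  proof -
    have "f ` {..<n} = {..<n}"
      using f_inj f_lt by (intro endo_inj_surj) auto
    then have "\<exists>i<n. j = f i" if "j < n" for j using that by (metis imageE lessThan_iff)
    then show ?thesis by (auto simp: P_def I_def)
  qed
  then have "card P = card (I X)"
    using card_I XY inj_on_subset[OF f_inj, of P] by (metis (no_types, lifting) P_def card_image lessThan_iff mem_Collect_eq subsetI)
  ultimately have PX: "P = I X" using fin by (simp add: card_subset_eq)
  \<comment> \<open>By \<open>PX\<close> every position in \<open>X\<close> precedes one in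
    \<open>Y\<close>; by \<open>fY\<close> every position in \<open>Y\<close> precedes one in
    \<open>X\<close>.\<close>
  have step: "f i \<in> I X \<union> I Y" if "i \<in> I X \<union> I Y" for i
    using that fY PX by (auto simp: P_def)
  obtain i0 where i0: "i0 \<in> I Y" using XY card_I[of Y] fin by (metis XY(2) all_not_in_conv card_I card_gt_0_iff finite_subset List.finite_set vs(3) card.empty)
  have reach: "(i0 + k) mod n \<in> I X \<union> I Y" for k
  proof (induction k)
    case 0
    then show ?case using i0 by (auto simp: I_def)
  next
    case (Suc k)
    from step[OF this] show ?case by (simp add: f_def mod_Suc_eq)
  qed
  obtain j where j: "j < n" "vs ! j = z" using z(1) vs(3) by (metis in_set_conv_nth n_def)
  have "i0 < n" using i0 by (simp add: I_def)
  then have "(i0 + (n - i0 + j)) mod n = j" using j by simp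
  then have "j \<in> I X \<union> I Y" using reach[of "n - i0 + j"] by simp
  then show False using j z by (auto simp: I_def)
qed

lemma no_hamilton_cycle:
  assumes a: "1 \<le> a"
  shows "\<not> has_hamilton_cycle (colorful_flip_graph [a, 1, 1, 1, 1, 1])"
proof
  let ?G = "colorful_flip_graph [a, 1, 1, 1, 1, 1]"
  have nodes: "fst ?G = tri a ` {c. valid a c}" by (rule colorful_flip_graph_nodes[OF a])
  define C where "C b = {c. valid a c \<and> (\<exists>p q s t. c = M p q s t \<and> even (q + of_bool s + of_bool t) = b)}" for b
  define X where "X = tri a ` C False"
  define Y where "Y = tri a ` C True"
  have sub: "C b \<subseteq> {c. valid a c}" for b by (auto simp: C_def)
  assume "has_hamilton_cycle ?G"
  then obtain vs where vs: "hamilton_cycle ?G vs" by (auto simp: has_hamilton_cycle_def)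
  show False
  proof (rule hamilton_cycle_obstruction[OF vs])
    show "X \<subseteq> fst ?G" "Y \<subseteq> fst ?G"
      unfolding X_def Y_def nodes using sub by blast+
    show "card X = card Y"
    proof -
      \<comment> \<open>Toggling the bit \<open>s\<close> is an involution that exchanges the two
        parities.\<close>
      define h where "h c = (case c of M p q s t \<Rightarrow> M p q (\<not> s) t | _ \<Rightarrow> c)" for c
      have hh: "h (h c) = c" for c by (auto simp: h_def split: cell.splits)
      have hC: "h c \<in> C (\<not> b)" if c_in: "c \<in> C b" for c b
      proof -
        obtain p q s t where c: "valid a c" "c = M p q s t" "even (q + of_bool s + of_bool t) = b"
          using c_in unfolding C_def by blast
        have "even (q + of_bool (\<not> s) + of_bool t) = (\<not> b)" using c(3) by (cases s; cases t) auto
        moreover have "valid a (M p q (\<not> s) t)" "h c = M p q (\<not> s) t" using c(1,2) by (simp_all add: h_def)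
        ultimately show ?thesis by (simp add: C_def)
      qed
      have "bij_betw h (C False) (C True)"
        by (rule bij_betw_byWitness[where f' = h]) (use hh hC[of _ False] hC[of _ True] in \<open>simp_all add: image_subset_iff\<close>)
      then have "card (C False) = card (C True)" by (rule bij_betw_same_card)
      then show ?thesis
        unfolding X_def Y_def using inj_on_subset[OF inj_on_tri sub] by (simp add: card_image)
    qed
    have "M 0 0 True True \<in> C True" using a by (auto simp: C_def)
    then show "Y \<noteq> {}" by (auto simp: Y_def)
    have "valid a (L 0 True True)" using a by simp
    then show "tri a (L 0 True True) \<in> fst ?G" unfolding nodes by blast
    show "tri a (L 0 True True) \<notin> X \<union> Y"
    proof
      assume "tri a (L 0 True True) \<in> X \<union> Y"
      then obtain c b where "c \<in> C b" "tri a (L 0 True True) = tri a c" by (auto simp: X_def Y_def)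
      then have "L 0 True True = c"
        using inj_onD[OF inj_on_tri, of a "L 0 True True" c] sub a by auto
      then show False using \<open>c \<in> C b\<close> by (auto simp: C_def)
    qed
    fix y v assume y: "y \<in> Y" and e: "{y, v} \<in> snd ?G"
    obtain c where "c \<in> C True" "y = tri a c" using y unfolding Y_def by blast
    then obtain p q s t where c: "valid a (M p q s t)" "y = tri a (M p q s t)" "even (q + of_bool s + of_bool t)"
      unfolding C_def mem_Collect_eq by metis
    have "v \<in> fst ?G" using e by (auto simp: colorful_flip_graph_def induced_subgraph_def)
    then obtain c' where c': "valid a c'" "v = tri a c'" unfolding nodes by blast
    have "exchange_one (tri a (M p q s t)) (tri a c')"
      using e[unfolded c(2) c'(2) colorful_flip_graph_edges[OF a c(1) c'(1)]] flip_imp_exchange_one exchange_one_sym by blast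
    then obtain p' q' s' t' where "c' = M p' q' s' t'" "odd (q' + of_bool s' + of_bool t')"
      using exchange_M[OF c(1) c'(1) _ c(3)] by blast
    then have "c' \<in> C False" using c'(1) by (simp add: C_def)
    then show "v \<in> X" using c'(2) unfolding X_def by blast
  qed
qed

section \<open>Hamilton paths\<close>

lemma chords_exchange:
  assumes "i < j" "k < l"
    and E': "\<And>x y. x < y \<Longrightarrow> E' x y \<longleftrightarrow> x = k \<and> y = l \<or> E x y \<and> \<not> (x = i \<and> y = j)"
  shows "chords E' = insert {k, l} (chords E - {{i, j}})"
proof (intro equalityI subsetI)
  fix d assume "d \<in> chords E'"
  then obtain x y where xy: "x < y" "d = {x, y}" "E' x y" unfolding chords_def by blast
  then show "d \<in> insert {k, l} (chords E - {{i, j}})"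
    using E'[OF xy(1)] assms(1) mem_chords[OF xy(1), of E] by (auto simp: doubleton_eq_iff)
next
  fix d assume d: "d \<in> insert {k, l} (chords E - {{i, j}})"
  show "d \<in> chords E'"
  proof (cases "d = {k, l}")
    case True
    then show ?thesis using E'[OF assms(2)] mem_chords[OF assms(2), of E'] by simp
  next
    case False
    then obtain x y where "x < y" "d = {x, y}" "E x y" "d \<noteq> {i, j}" using d unfolding chords_def by blast
    then show ?thesis using E'[of x y] mem_chords[of x y E'] by auto
  qed
qed

lemma flipI:
  assumes "{i, j} \<in> T" "i \<noteq> j" "k \<noteq> l" "k \<notin> {i, j}" "l \<notin> {i, j}"
    "{i, k} \<in> sides N \<union> T" "{j, k} \<in> sides N \<union> T" "{i, l} \<in> sides N \<union> T" "{j, l} \<in> sides N \<union> T"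
  shows "flip N T (insert {k, l} (T - {{i, j}}))"
proof -
  have "{i, j, x} \<in> triangles N T" if "x \<notin> {i, j}" "{i, x} \<in> sides N \<union> T" "{j, x} \<in> sides N \<union> T" for x
    using that assms(1,2) unfolding triangles_def by blast
  then show ?thesis using assms unfolding flip_def by blast
qed

definition side_or :: "nat \<Rightarrow> (nat \<Rightarrow> nat \<Rightarrow> bool) \<Rightarrow> nat \<Rightarrow> nat \<Rightarrow> bool" where
  "side_or N E x y \<longleftrightarrow> 1 \<le> x \<and> y \<le> N \<and> (y = Suc x \<or> x = 1 \<and> y = N) \<or> E x y"

lemma mem_side_or: "0 < N \<Longrightarrow> x < y \<Longrightarrow> {x, y} \<in> sides N \<union> chords E \<longleftrightarrow> side_or N E x y"
  by (simp add: side_or_def mem_sides mem_chords)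

definition quad :: "nat \<Rightarrow> (nat \<Rightarrow> nat \<Rightarrow> bool) \<Rightarrow> nat \<Rightarrow> nat \<Rightarrow> nat \<Rightarrow> nat \<Rightarrow> bool" where
  "quad N E w x y z \<longleftrightarrow> 0 < N \<and> w < x \<and> x < y \<and> y < z \<and>
     side_or N E w x \<and> side_or N E x y \<and> side_or N E y z \<and> side_or N E w z"

text \<open>All four edges around the quadrilateral are present, so whichever of its diagonals is in
  the set borders two triangles. The two parts are the two directions of the exchange.\<close>

lemma flip_quad:
  assumes q: "quad N E w x y z"
  shows "E w y \<Longrightarrow> (\<And>i j. i < j \<Longrightarrow> E' i j \<longleftrightarrow> i = x \<and> j = z \<or> E i j \<and> \<not> (i = w \<and> j = y)) \<Longrightarrow>
      flip N (chords E) (chords E')"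
    and "E x z \<Longrightarrow> (\<And>i j. i < j \<Longrightarrow> E' i j \<longleftrightarrow> i = w \<and> j = y \<or> E i j \<and> \<not> (i = x \<and> j = z)) \<Longrightarrow>
      flip N (chords E) (chords E')"
proof -
  have ord: "w < x" "x < y" "y < z" using q by (auto simp: quad_def)
  have "{w, x} \<in> sides N \<union> chords E" "{x, y} \<in> sides N \<union> chords E"
    "{y, z} \<in> sides N \<union> chords E" "{w, z} \<in> sides N \<union> chords E"
    using q mem_side_or[of N] unfolding quad_def by auto
  note ed = this this[unfolded insert_commute[of _ _ "{}"]]
  show "flip N (chords E) (chords E')" if E: "E w y"
    and E': "\<And>i j. i < j \<Longrightarrow> E' i j \<longleftrightarrow> i = x \<and> j = z \<or> E i j \<and> \<not> (i = w \<and> j = y)"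
  proof -
    have "flip N (chords E) (insert {x, z} (chords E - {{w, y}}))"
      by (rule flipI) (use ord ed E mem_chords[of w y E] in \<open>auto simp: insert_commute\<close>)
    moreover have "chords E' = insert {x, z} (chords E - {{w, y}})"
      by (rule chords_exchange) (use ord E' in auto)
    ultimately show ?thesis by simp
  qed
  show "flip N (chords E) (chords E')" if E: "E x z"
    and E': "\<And>i j. i < j \<Longrightarrow> E' i j \<longleftrightarrow> i = w \<and> j = y \<or> E i j \<and> \<not> (i = x \<and> j = z)"
  proof -
    have "flip N (chords E) (insert {w, y} (chords E - {{x, z}}))"
      by (rule flipI) (use ord ed E mem_chords[of x z E] in \<open>auto simp: insert_commute\<close>)
    moreover have "chords E' = insert {w, y} (chords E - {{x, z}})"
      by (rule chords_exchange) (use ord E' in auto)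
    ultimately show ?thesis by simp
  qed
qed

section \<open>The thirteen types of flips between cells\<close>

lemma flip_M_s: "p + q < a \<Longrightarrow> flip (a + 5) (tri a (M p q False t)) (tri a (M p q True t))"
  unfolding tri_def
proof (rule flip_quad(1)[of _ _ "p + q + 1" "a + 1" "a + 2" "a + 3"])
  assume *: "p + q < a"
  show "quad (a + 5) (seg a (M p q False t)) (p + q + 1) (a + 1) (a + 2) (a + 3)"
    using * by (simp add: quad_def side_or_def) linarith?
  show "seg a (M p q False t) (p + q + 1) (a + 2)"
    using * by simp
  show "seg a (M p q True t) i j \<longleftrightarrow> i = a + 1 \<and> j = a + 3 \<or> seg a (M p q False t) i j \<and> \<not> (i = p + q + 1 \<and> j = a + 2)" for i j
    using * by auto
qed

lemma flip_M_t: "p + q < a \<Longrightarrow> flip (a + 5) (tri a (M p q s False)) (tri a (M p q s True))"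
  unfolding tri_def
proof (rule flip_quad(1)[of _ _ "p + 1" "a + 3" "a + 4" "a + 5"])
  assume *: "p + q < a"
  show "quad (a + 5) (seg a (M p q s False)) (p + 1) (a + 3) (a + 4) (a + 5)"
    using * by (simp add: quad_def side_or_def) linarith?
  show "seg a (M p q s False) (p + 1) (a + 4)"
    using * by simp
  show "seg a (M p q s True) i j \<longleftrightarrow> i = a + 3 \<and> j = a + 5 \<or> seg a (M p q s False) i j \<and> \<not> (i = p + 1 \<and> j = a + 4)" for i j
    using * by auto
qed

text \<open>The triangle on the base \<open>{p + 1, p + 2}\<close> changes its apex from
  \<open>a + 5\<close> to \<open>a + 3\<close>. The bit \<open>t\<close> must be true because the
  blue diagonal \<open>{a + 3, a + 5}\<close> is the fourth edge of the quadrilateral. In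
  \<open>flip_M_q\<close> the bit \<open>s\<close> plays this part for the apexes
  \<open>a + 3\<close> and \<open>a + 1\<close>.\<close>

lemma flip_M_p: "Suc (p + q) < a \<Longrightarrow> flip (a + 5) (tri a (M (Suc p) q s True)) (tri a (M p (Suc q) s True))"
  unfolding tri_def
proof (rule flip_quad(2)[of _ _ "p + 1" "p + 2" "a + 3" "a + 5"])
  assume *: "Suc (p + q) < a"
  show "quad (a + 5) (seg a (M (Suc p) q s True)) (p + 1) (p + 2) (a + 3) (a + 5)"
    using * by (simp add: quad_def side_or_def) linarith?
  show "seg a (M (Suc p) q s True) (p + 2) (a + 5)"
    using * by simp
  show "seg a (M p (Suc q) s True) i j \<longleftrightarrow> i = p + 1 \<and> j = a + 3 \<or> seg a (M (Suc p) q s True) i j \<and> \<not> (i = p + 2 \<and> j = a + 5)" for i j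
  proof -
    consider "j = a + 1" | "j = a + 3" | "j = a + 5" | "j \<notin> {a + 1, a + 3, a + 5}" by blast
    then show ?thesis by cases (use * in auto)
  qed
qed

lemma flip_M_q: "Suc (p + q) < a \<Longrightarrow> flip (a + 5) (tri a (M p (Suc q) True t)) (tri a (M p q True t))"
  unfolding tri_def
proof (rule flip_quad(2)[of _ _ "p + q + 1" "p + q + 2" "a + 1" "a + 3"])
  assume *: "Suc (p + q) < a"
  show "quad (a + 5) (seg a (M p (Suc q) True t)) (p + q + 1) (p + q + 2) (a + 1) (a + 3)"
    using * by (simp add: quad_def side_or_def) linarith?
  show "seg a (M p (Suc q) True t) (p + q + 2) (a + 3)"
    using * by simp
  show "seg a (M p q True t) i j \<longleftrightarrow> i = p + q + 1 \<and> j = a + 1 \<or> seg a (M p (Suc q) True t) i j \<and> \<not> (i = p + q + 2 \<and> j = a + 3)" for i j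
  proof -
    consider "j = a + 1" | "j = a + 3" | "j = a + 5" | "j \<notin> {a + 1, a + 3, a + 5}" by blast
    then show ?thesis by cases (use * in auto)
  qed
qed

text \<open>This lemma and the next two exchange the diagonal of the contracted hexagon. The two
  bits on each side are those for which the free diagonals bound the quadrilateral around
  it.\<close>

lemma flip_M_R: "p < a \<Longrightarrow> flip (a + 5) (tri a (M p 0 False True)) (tri a (R p True False))"
  unfolding tri_def
proof (rule flip_quad(1)[of _ _ "p + 1" "a + 2" "a + 3" "a + 5"])
  assume *: "p < a"
  show "quad (a + 5) (seg a (M p 0 False True)) (p + 1) (a + 2) (a + 3) (a + 5)"
    using * by (simp add: quad_def side_or_def) linarith?
  show "seg a (M p 0 False True) (p + 1) (a + 3)"
    using * by simp
  show "seg a (R p True False) i j \<longleftrightarrow> i = a + 2 \<and> j = a + 5 \<or> seg a (M p 0 False True) i j \<and> \<not> (i = p + 1 \<and> j = a + 3)" for i j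
    using * by auto
qed

lemma flip_M_L: "p < a \<Longrightarrow> flip (a + 5) (tri a (M p 0 True False)) (tri a (L p True False))"
  unfolding tri_def
proof (rule flip_quad(1)[of _ _ "p + 1" "a + 1" "a + 3" "a + 4"])
  assume *: "p < a"
  show "quad (a + 5) (seg a (M p 0 True False)) (p + 1) (a + 1) (a + 3) (a + 4)"
    using * by (simp add: quad_def side_or_def) linarith?
  show "seg a (M p 0 True False) (p + 1) (a + 3)"
    using * by simp
  show "seg a (L p True False) i j \<longleftrightarrow> i = a + 1 \<and> j = a + 4 \<or> seg a (M p 0 True False) i j \<and> \<not> (i = p + 1 \<and> j = a + 3)" for i j
    using * by auto
qed

lemma flip_L_R: "p < a \<Longrightarrow> flip (a + 5) (tri a (L p False True)) (tri a (R p False True))"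
  unfolding tri_def
proof (rule flip_quad(1)[of _ _ "a + 1" "a + 2" "a + 4" "a + 5"])
  assume *: "p < a"
  show "quad (a + 5) (seg a (L p False True)) (a + 1) (a + 2) (a + 4) (a + 5)"
    using * by (simp add: quad_def side_or_def) linarith?
  show "seg a (L p False True) (a + 1) (a + 4)"
    using * by simp
  show "seg a (R p False True) i j \<longleftrightarrow> i = a + 2 \<and> j = a + 5 \<or> seg a (L p False True) i j \<and> \<not> (i = a + 1 \<and> j = a + 4)" for i j
    using * by auto
qed

lemma flip_L_s: "p < a \<Longrightarrow> flip (a + 5) (tri a (L p False t)) (tri a (L p True t))"
  unfolding tri_def
proof (rule flip_quad(2)[of _ _ "a + 1" "a + 2" "a + 3" "a + 4"])
  assume *: "p < a"
  show "quad (a + 5) (seg a (L p False t)) (a + 1) (a + 2) (a + 3) (a + 4)"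
    using * by (simp add: quad_def side_or_def) linarith?
  show "seg a (L p False t) (a + 2) (a + 4)"
    using * by simp
  show "seg a (L p True t) i j \<longleftrightarrow> i = a + 1 \<and> j = a + 3 \<or> seg a (L p False t) i j \<and> \<not> (i = a + 2 \<and> j = a + 4)" for i j
    using * by auto
qed

lemma flip_L_t: "p < a \<Longrightarrow> flip (a + 5) (tri a (L p s False)) (tri a (L p s True))"
  unfolding tri_def
proof (rule flip_quad(1)[of _ _ "p + 1" "a + 1" "a + 4" "a + 5"])
  assume *: "p < a"
  show "quad (a + 5) (seg a (L p s False)) (p + 1) (a + 1) (a + 4) (a + 5)"
    using * by (simp add: quad_def side_or_def) linarith?
  show "seg a (L p s False) (p + 1) (a + 4)"
    using * by simp
  show "seg a (L p s True) i j \<longleftrightarrow> i = a + 1 \<and> j = a + 5 \<or> seg a (L p s False) i j \<and> \<not> (i = p + 1 \<and> j = a + 4)" for i j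
    using * by auto
qed

lemma flip_L_p: "Suc p < a \<Longrightarrow> flip (a + 5) (tri a (L (Suc p) s True)) (tri a (L p s True))"
  unfolding tri_def
proof (rule flip_quad(2)[of _ _ "p + 1" "p + 2" "a + 1" "a + 5"])
  assume *: "Suc p < a"
  show "quad (a + 5) (seg a (L (Suc p) s True)) (p + 1) (p + 2) (a + 1) (a + 5)"
    using * by (simp add: quad_def side_or_def) linarith?
  show "seg a (L (Suc p) s True) (p + 2) (a + 5)"
    using * by simp
  show "seg a (L p s True) i j \<longleftrightarrow> i = p + 1 \<and> j = a + 1 \<or> seg a (L (Suc p) s True) i j \<and> \<not> (i = p + 2 \<and> j = a + 5)" for i j
    using * by auto
qed

lemma flip_R_s: "p < a \<Longrightarrow> flip (a + 5) (tri a (R p False t)) (tri a (R p True t))"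
  unfolding tri_def
proof (rule flip_quad(1)[of _ _ "a + 2" "a + 3" "a + 4" "a + 5"])
  assume *: "p < a"
  show "quad (a + 5) (seg a (R p False t)) (a + 2) (a + 3) (a + 4) (a + 5)"
    using * by (simp add: quad_def side_or_def) linarith?
  show "seg a (R p False t) (a + 2) (a + 4)"
    using * by simp
  show "seg a (R p True t) i j \<longleftrightarrow> i = a + 3 \<and> j = a + 5 \<or> seg a (R p False t) i j \<and> \<not> (i = a + 2 \<and> j = a + 4)" for i j
    using * by auto
qed

lemma flip_R_t: "p < a \<Longrightarrow> flip (a + 5) (tri a (R p s False)) (tri a (R p s True))"
  unfolding tri_def
proof (rule flip_quad(1)[of _ _ "p + 1" "a + 1" "a + 2" "a + 5"])
  assume *: "p < a"
  show "quad (a + 5) (seg a (R p s False)) (p + 1) (a + 1) (a + 2) (a + 5)"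
    using * by (simp add: quad_def side_or_def) linarith?
  show "seg a (R p s False) (p + 1) (a + 2)"
    using * by simp
  show "seg a (R p s True) i j \<longleftrightarrow> i = a + 1 \<and> j = a + 5 \<or> seg a (R p s False) i j \<and> \<not> (i = p + 1 \<and> j = a + 2)" for i j
    using * by auto
qed

lemma flip_R_p: "Suc p < a \<Longrightarrow> flip (a + 5) (tri a (R (Suc p) s True)) (tri a (R p s True))"
  unfolding tri_def
proof (rule flip_quad(2)[of _ _ "p + 1" "p + 2" "a + 1" "a + 5"])
  assume *: "Suc p < a"
  show "quad (a + 5) (seg a (R (Suc p) s True)) (p + 1) (p + 2) (a + 1) (a + 5)"
    using * by (simp add: quad_def side_or_def) linarith?
  show "seg a (R (Suc p) s True) (p + 2) (a + 5)"
    using * by simp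
  show "seg a (R p s True) i j \<longleftrightarrow> i = p + 1 \<and> j = a + 1 \<or> seg a (R (Suc p) s True) i j \<and> \<not> (i = p + 2 \<and> j = a + 5)" for i j
    using * by auto
qed

lemmas flip_tri = flip_M_s flip_M_t flip_M_p flip_M_q flip_M_R flip_M_L flip_L_R flip_L_s flip_L_t flip_L_p flip_R_s flip_R_t flip_R_p

lemma flip_arc:
  assumes "arc c c'" "valid a c" "valid a c'"
  shows "flip (a + 5) (tri a c) (tri a c')"
  using assms by (cases c; cases c') (auto intro: flip_tri)

section \<open>Paths of cells and insertion of detours\<close>

definition adj :: "cell \<Rightarrow> cell \<Rightarrow> bool" where
  "adj u v \<longleftrightarrow> arc u v \<or> arc v u"

lemma adj_sym: "adj u v \<Longrightarrow> adj v u"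
  by (auto simp: adj_def)

text \<open>Edges are unordered, since the direction in which a path traverses a given edge is not
  tracked.\<close>

fun list_edges :: "'a list \<Rightarrow> 'a set set" where
  "list_edges (x # y # zs) = insert {x, y} (list_edges (y # zs))"
| "list_edges _ = {}"

lemma list_edges_append:
  "xs \<noteq> [] \<Longrightarrow> ys \<noteq> [] \<Longrightarrow>
   list_edges (xs @ ys) = list_edges xs \<union> list_edges ys \<union> {{last xs, hd ys}}"
proof (induction xs rule: list_edges.induct)
  case ("2_2" v)
  then show ?case by (cases ys) auto
qed auto

lemma list_edges_rev: "list_edges (rev xs) = list_edges xs"
proof (induction xs rule: list_edges.induct)
  case (1 x y zs)
  then show ?case by (auto simp: list_edges_append[of "rev zs @ [y]" "[x]", simplified])
qed auto

lemma list_edges_split: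
  "{u, v} \<in> list_edges vs \<Longrightarrow> \<exists>xs ys. vs = xs @ u # v # ys \<or> vs = xs @ v # u # ys"
proof (induction vs rule: list_edges.induct)
  case (1 x y zs)
  show ?case
  proof (cases "{u, v} = {x, y}")
    case True
    then have "u = x \<and> v = y \<or> u = y \<and> v = x" by (simp add: doubleton_eq_iff)
    then show ?thesis by (metis append_Nil)
  next
    case False
    then have "{u, v} \<in> list_edges (y # zs)" using 1(2) by auto
    then obtain xs ys where "y # zs = xs @ u # v # ys \<or> y # zs = xs @ v # u # ys"
      using 1(1) by blast
    then show ?thesis by (metis append_Cons)
  qed
qed auto

definition adj_path :: "cell list \<Rightarrow> bool" where
  "adj_path vs \<longleftrightarrow> distinct vs \<and> successively adj vs"

lemma adj_path_rev: "adj_path (rev vs) \<longleftrightarrow> adj_path vs"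
proof -
  have "(\<lambda>x y. adj y x) = adj" by (intro ext) (auto simp: adj_def)
  from arg_cong[OF this, of "\<lambda>f. successively f vs"] show ?thesis
    by (simp add: adj_path_def)
qed

text \<open>If the path traverses the edge from \<open>v\<close> to \<open>u\<close>, the reversed
  detour is inserted. All other edges survive and the edges of the detour are added, so later
  insertions still find their places.\<close>

lemma adj_path_insert:
  assumes "adj_path vs" "{u, v} \<in> list_edges vs" "adj_path ws" "ws \<noteq> []"
    "set ws \<inter> set vs = {}" "adj u (hd ws)" "adj (last ws) v"
  shows "\<exists>vs'. adj_path vs' \<and> set vs' = set vs \<union> set ws \<and>
           list_edges vs - {{u, v}} \<union> list_edges ws \<subseteq> list_edges vs'"
proof -
  have main: "\<exists>vs'. adj_path vs' \<and> set vs' = set vs \<union> set ws \<and>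
           list_edges vs - {{u, v}} \<union> list_edges ws \<subseteq> list_edges vs'"
    if h: "vs = xs @ u # v # ys" "adj_path ws" "ws \<noteq> []"
      "set ws \<inter> set vs = {}" "adj u (hd ws)" "adj (last ws) v"
    for xs ys u v ws
  proof (intro exI conjI)
    let ?vs = "(xs @ [u]) @ ws @ (v # ys)"
    have vs: "vs = (xs @ [u]) @ (v # ys)" using h(1) by simp
    show "adj_path ?vs"
      using assms(1) h(2-) unfolding adj_path_def vs
      by (auto simp: successively_append_iff successively_Cons)
    show "set ?vs = set vs \<union> set ws" using vs by auto
    have "list_edges vs = list_edges (xs @ [u]) \<union> list_edges (v # ys) \<union> {{u, v}}"
      unfolding vs by (subst list_edges_append) auto
    moreover have "list_edges ?vs = list_edges (xs @ [u]) \<union> list_edges ws \<union> list_edges (v # ys) \<union>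
        {{last ws, v}, {u, hd ws}}"
      using h(3) by (subst list_edges_append, simp, simp, subst list_edges_append) auto
    ultimately show "list_edges vs - {{u, v}} \<union> list_edges ws \<subseteq> list_edges ?vs" by auto
  qed
  obtain xs ys where "vs = xs @ u # v # ys \<or> vs = xs @ v # u # ys"
    using list_edges_split[OF assms(2)] by blast
  then show ?thesis
  proof
    assume "vs = xs @ u # v # ys"
    then show ?thesis using main assms by blast
  next
    assume "vs = xs @ v # u # ys"
    then show ?thesis
      using main[of xs v u ys "rev ws"] assms(3-5) adj_sym[OF assms(6)] adj_sym[OF assms(7)]
      by (simp add: adj_path_rev list_edges_rev hd_rev last_rev insert_commute)
  qed
qed

text \<open>Distinct edges and disjoint blocks keep the insertions independent: none of them
  destroys the place of another.\<close>

lemma adj_path_insert_family: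
  assumes "finite I" "adj_path vs"
    and blocks: "\<And>i. i \<in> I \<Longrightarrow> adj_path (ws i) \<and> ws i \<noteq> [] \<and> adj (u i) (hd (ws i)) \<and> adj (last (ws i)) (v i)"
    and anchors: "\<And>i. i \<in> I \<Longrightarrow> {u i, v i} \<in> list_edges vs"
    and inj: "\<And>i j. i \<in> I \<Longrightarrow> j \<in> I \<Longrightarrow> i \<noteq> j \<Longrightarrow> {u i, v i} \<noteq> {u j, v j} \<and> set (ws i) \<inter> set (ws j) = {}"
    and disj: "\<And>i. i \<in> I \<Longrightarrow> set (ws i) \<inter> set vs = {}"
  shows "\<exists>vs'. adj_path vs' \<and> set vs' = set vs \<union> (\<Union>i\<in>I. set (ws i)) \<and>
           list_edges vs - (\<lambda>i. {u i, v i}) ` I \<union> (\<Union>i\<in>I. list_edges (ws i)) \<subseteq> list_edges vs'"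
  using assms
proof (induction I rule: finite_induct)
  case empty
  then show ?case by auto
next
  case (insert i I)
  have "\<exists>vs'. adj_path vs' \<and> set vs' = set vs \<union> (\<Union>i\<in>I. set (ws i)) \<and>
      list_edges vs - (\<lambda>i. {u i, v i}) ` I \<union> (\<Union>i\<in>I. list_edges (ws i)) \<subseteq> list_edges vs'"
    by (rule insert.IH) (use insert.prems in \<open>simp_all\<close>)
  then obtain vs' where vs': "adj_path vs'" "set vs' = set vs \<union> (\<Union>i\<in>I. set (ws i))"
    "list_edges vs - (\<lambda>i. {u i, v i}) ` I \<union> (\<Union>i\<in>I. list_edges (ws i)) \<subseteq> list_edges vs'"
    by blast
  have ne: "{u i, v i} \<noteq> {u j, v j}" "set (ws i) \<inter> set (ws j) = {}" if "j \<in> I" for j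
    using insert.prems(4)[of i j] insert.hyps that by auto
  have "{u i, v i} \<in> list_edges vs'" using insert.prems(3)[of i] ne vs'(3) by blast
  moreover have "set (ws i) \<inter> set vs' = {}" using insert.prems(5)[of i] ne vs'(2) by blast
  ultimately obtain vs'' where vs'': "adj_path vs''" "set vs'' = set vs' \<union> set (ws i)"
    "list_edges vs' - {{u i, v i}} \<union> list_edges (ws i) \<subseteq> list_edges vs''"
    using adj_path_insert[of vs' "u i" "v i" "ws i"] insert.prems(2)[of i] vs'(1) by auto
  \<comment> \<open>The edge removed for block \<open>i\<close> has its ends in \<open>vs\<close>,
    which every block avoids. Hence the edges of the earlier blocks survive.\<close>
  have "{u i, v i} \<notin> list_edges (ws j)" if "j \<in> I" for j
  proof
    assume "{u i, v i} \<in> list_edges (ws j)"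
    then have "u i \<in> set (ws j)" by (auto dest!: list_edges_split)
    moreover have "u i \<in> set vs" using insert.prems(3)[of i] by (auto dest!: list_edges_split)
    ultimately show False using insert.prems(5)[of j] that by auto
  qed
  then have "list_edges vs - (\<lambda>i. {u i, v i}) ` insert i I \<union> (\<Union>i\<in>insert i I. list_edges (ws i)) \<subseteq> list_edges vs''"
    using vs'(3) vs''(3) by auto
  moreover have "set vs'' = set vs \<union> (\<Union>i\<in>insert i I. set (ws i))" using vs'(2) vs''(2) by auto
  ultimately show ?case using vs''(1) by blast
qed

section \<open>Detour blocks and starting paths\<close>

definition block_edge :: "nat \<Rightarrow> nat \<Rightarrow> cell set" where
  "block_edge p q = {M p q True False, M p q True True}"

text \<open>All 16 cells in columns \<open>p\<close> and \<open>p + 1\<close> on the antidiagonals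
  \<open>p + q + 2\<close> and \<open>p + q + 3\<close>. It fits into
  \<open>block_edge (Suc p) q\<close>: both ends of that edge have \<open>s\<close> true, so a flip
  raising \<open>q\<close> leads to the two ends of the block. Inside it lies
  \<open>block_edge (Suc p) (q + 2)\<close>, the place for the next round.\<close>

definition square_block :: "nat \<Rightarrow> nat \<Rightarrow> cell list" where
  "square_block p q =
    [M (Suc p) (q + 1) True False, M (Suc p) (q + 1) False False, M (Suc p) (q + 1) False True,
     M p (q + 2) False True, M p (q + 2) False False, M p (q + 2) True False, M p (q + 2) True True,
     M p (q + 3) True True, M p (q + 3) True False, M p (q + 3) False False, M p (q + 3) False True,
     M (Suc p) (q + 2) False True, M (Suc p) (q + 2) False False, M (Suc p) (q + 2) True False,
     M (Suc p) (q + 2) True True, M (Suc p) (q + 1) True True]"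

text \<open>The 12 new \<open>M\<close> cells with \<open>p > m\<close>, to be inserted between
  \<open>M m 2 True True\<close> and \<open>M m 1 True True\<close>. It provides
  \<open>block_edge (m + 2) 0\<close> for the next round.\<close>

definition corner_block :: "nat \<Rightarrow> cell list" where
  "corner_block m =
    [M (m + 1) 1 True True, M (m + 2) 0 True True, M (m + 2) 0 True False, M (m + 2) 0 False False,
     M (m + 2) 0 False True, M (m + 1) 1 False True, M (m + 1) 1 False False, M (m + 1) 1 True False,
     M (m + 1) 0 True False, M (m + 1) 0 False False, M (m + 1) 0 False True, M (m + 1) 0 True True]"

text \<open>The new \<open>M\<close> cells of column 0, which the pairing of columns leaves over
  when \<open>m\<close> is even.\<close>

definition column_block :: "nat \<Rightarrow> cell list" where
  "column_block m =
    [M 0 (m + 1) True True, M 0 (m + 1) False True, M 0 (m + 1) False False, M 0 (m + 1) True False,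
     M 0 (m + 2) True False, M 0 (m + 2) False False, M 0 (m + 2) False True, M 0 (m + 2) True True]"

text \<open>Goes up through the \<open>L\<close> cells and back through the \<open>R\<close> cells.
  Its middle edge from \<open>L\<close> to \<open>R\<close> at \<open>m + 2\<close> is the place for
  the next round.\<close>

definition LR_block :: "nat \<Rightarrow> cell list" where
  "LR_block m =
    [L (m + 1) False True, L (m + 1) False False, L (m + 1) True False, L (m + 1) True True,
     L (m + 2) True True, L (m + 2) True False, L (m + 2) False False, L (m + 2) False True,
     R (m + 2) False True, R (m + 2) False False, R (m + 2) True False, R (m + 2) True True,
     R (m + 1) True True, R (m + 1) True False, R (m + 1) False False, R (m + 1) False True]"

text \<open>Each group of four consecutive entries exhausts the bits over one choice of kind and
  counts before the path moves on.\<close>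

definition base_2 :: "cell list" where
  "base_2 =
    [M 1 0 True True, M 1 0 True False, M 1 0 False False, M 1 0 False True,
     M 0 1 False True, M 0 1 False False, M 0 1 True False, M 0 1 True True,
     M 0 0 True True, M 0 0 False True, M 0 0 False False, M 0 0 True False,
     L 0 True False, L 0 False False, L 0 False True, L 0 True True,
     L 1 True True, L 1 True False, L 1 False False, L 1 False True,
     R 1 False True, R 1 False False, R 1 True False, R 1 True True,
     R 0 True True, R 0 True False, R 0 False False, R 0 False True]"

text \<open>Found by computer search.\<close>

definition base_5 :: "cell list" where
  "base_5 =
    [M 0 3 False True, M 0 3 False False, M 0 3 True False, M 0 4 True False, M 0 4 False False,
     M 0 4 False True, M 0 4 True True, M 0 3 True True, M 0 2 True True, M 0 2 True False,
     M 0 2 False False, M 0 2 False True, M 1 1 False True, M 1 1 False False, M 1 1 True False,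
     M 1 2 True False, M 1 2 False False, M 1 2 False True, M 1 2 True True, M 1 3 True True,
     M 1 3 True False, M 1 3 False False, M 1 3 False True, M 2 2 False True, M 2 2 False False,
     M 2 2 True False, M 2 2 True True, M 3 1 True True, M 4 0 True True, M 4 0 True False,
     M 4 0 False False, M 4 0 False True, M 3 1 False True, M 3 1 False False, M 3 1 True False,
     M 3 0 True False, M 3 0 False False, M 3 0 False True, M 3 0 True True, M 2 1 True True,
     M 2 1 False True, M 2 1 False False, M 2 1 True False, M 2 0 True False, M 2 0 False False,
     M 2 0 False True, M 2 0 True True, M 1 1 True True, M 1 0 True True, M 0 1 True True,
     M 0 0 True True, M 0 0 False True, M 0 0 False False, M 0 0 True False, M 0 1 True False,
     M 0 1 False False, M 0 1 False True, M 1 0 False True, R 1 True False, R 1 False False,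
     R 1 False True, R 0 False True, R 0 False False, R 0 True False, R 0 True True,
     R 1 True True, R 2 True True, R 2 True False, R 2 False False, R 2 False True,
     R 3 False True, R 3 False False, R 3 True False, R 3 True True, R 4 True True,
     R 4 True False, R 4 False False, R 4 False True, L 4 False True, L 4 False False,
     L 4 True False, L 4 True True, L 3 True True, L 3 True False, L 3 False False,
     L 3 False True, L 2 False True, L 2 False False, L 2 True False, L 2 True True,
     L 1 True True, L 0 True True, L 0 True False, L 0 False False, L 0 False True,
     L 1 False True, L 1 False False, L 1 True False, M 1 0 True False, M 1 0 False False]"

text \<open>The last two conditions provide the edges at which blocks are inserted to pass from
  \<open>a = m + 1\<close> to \<open>a = m + 3\<close>.\<close>

definition extendable :: "nat \<Rightarrow> cell list \<Rightarrow> bool" where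
  "extendable m vs \<longleftrightarrow> adj_path vs \<and> set vs = {c. valid (Suc m) c} \<and>
     {L m False True, R m False True} \<in> list_edges vs \<and>
     (\<forall>p q. 1 \<le> p \<longrightarrow> p + q = m \<longrightarrow> even q \<longrightarrow> block_edge p q \<in> list_edges vs)"

lemma adj_path_base_2: "adj_path base_2"
  by code_simp

lemma adj_path_base_5: "adj_path base_5"
  by code_simp

text \<open>Makes the set of valid cells executable, so that the starting paths can be checked by
  evaluation.\<close>

definition cell_list :: "nat \<Rightarrow> cell list" where
  "cell_list a = [M p q s t. p \<leftarrow> [0..<a], q \<leftarrow> [0..<a - p], s \<leftarrow> [False, True], t \<leftarrow> [False, True]] @
     [C p s t. C \<leftarrow> [L, R], p \<leftarrow> [0..<a], s \<leftarrow> [False, True], t \<leftarrow> [False, True]]"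

lemma set_cell_list: "set (cell_list a) = {c. valid a c}"
proof -
  have "c \<in> set (cell_list a) \<longleftrightarrow> valid a c" for c
  proof (cases c)
    case (M p q s t)
    then show ?thesis by (cases s; cases t) (auto simp: cell_list_def)
  qed (auto simp: cell_list_def)
  then show ?thesis by auto
qed

lemma extendable_base_2: "extendable 1 base_2"
proof -
  have "set base_2 = {c. valid (Suc 1) c}"
    unfolding set_cell_list[symmetric] by code_simp
  moreover have "block_edge 1 0 \<in> list_edges base_2" "{L 1 False True, R 1 False True} \<in> list_edges base_2"
    by (simp_all add: base_2_def block_edge_def doubleton_eq_iff)
  ultimately show ?thesis
    using adj_path_base_2 unfolding extendable_def by (auto simp: add_is_1)
qed

lemma extendable_base_5: "extendable 4 base_5"
proof -
  have "set base_5 = {c. valid (Suc 4) c}"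
    unfolding set_cell_list[symmetric] by code_simp
  moreover have "block_edge 4 0 \<in> list_edges base_5" "block_edge 2 2 \<in> list_edges base_5"
      "{L 4 False True, R 4 False True} \<in> list_edges base_5"
    by (simp_all add: base_5_def block_edge_def doubleton_eq_iff)
  moreover have "p = 4 \<and> q = 0 \<or> p = 2 \<and> q = 2" if "1 \<le> p" "p + q = 4" "even q" for p q :: nat
    using that by presburger
  ultimately show ?thesis
    using adj_path_base_5 unfolding extendable_def by blast
qed

section \<open>Extending a path by two red points\<close>

lemma adj_path_square_block: "adj_path (square_block p q)"
  by (simp add: adj_path_def square_block_def adj_def)

lemma adj_path_corner_block: "adj_path (corner_block m)"
  by (simp add: adj_path_def corner_block_def adj_def)

lemma adj_path_column_block: "adj_path (column_block m)"
  by (simp add: adj_path_def column_block_def adj_def)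

lemma adj_path_LR_block: "adj_path (LR_block m)"
  by (simp add: adj_path_def LR_block_def adj_def)

lemma set_square_block:
  "M x y s t \<in> set (square_block p q) \<longleftrightarrow> (x = p \<or> x = Suc p) \<and> (x + y = p + q + 2 \<or> x + y = p + q + 3)"
  "L x s t \<notin> set (square_block p q)" "R x s t \<notin> set (square_block p q)"
  by (cases s; cases t; auto simp: square_block_def)+

lemma set_corner_block:
  "M x y s t \<in> set (corner_block m) \<longleftrightarrow> m < x \<and> x + y \<le> m + 2 \<and> m < x + y"
  "L x s t \<notin> set (corner_block m)" "R x s t \<notin> set (corner_block m)"
  by (cases s; cases t; auto simp: corner_block_def)+

lemma set_column_block:
  "M x y s t \<in> set (column_block m) \<longleftrightarrow> x = 0 \<and> (y = m + 1 \<or> y = m + 2)"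
  "L x s t \<notin> set (column_block m)" "R x s t \<notin> set (column_block m)"
  by (cases s; cases t; auto simp: column_block_def)+

lemma set_LR_block:
  "M x y s t \<notin> set (LR_block m)"
  "L x s t \<in> set (LR_block m) \<longleftrightarrow> x = m + 1 \<or> x = m + 2"
  "R x s t \<in> set (LR_block m) \<longleftrightarrow> x = m + 1 \<or> x = m + 2"
  by (cases s; cases t; auto simp: LR_block_def)+

lemma cell_disjointI:
  assumes "\<And>p q s t. M p q s t \<in> A \<Longrightarrow> M p q s t \<notin> B"
    "\<And>p s t. L p s t \<in> A \<Longrightarrow> L p s t \<notin> B" "\<And>p s t. R p s t \<in> A \<Longrightarrow> R p s t \<notin> B"
  shows "A \<inter> B = {}"
proof -
  have "c \<notin> B" if "c \<in> A" for c using assms that by (cases c) auto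
  then show ?thesis by auto
qed

lemma extendable_step:
  assumes ext: "extendable m vs" and m: "1 \<le> m"
  shows "\<exists>vs'. extendable (m + 2) vs'"
proof -
  \<comment> \<open>The left columns \<open>m - 1\<close>, \<open>m - 3\<close>, ... of the column
    pairs, counted down from column \<open>m\<close>. The block for \<open>p\<close> is inserted in
    column \<open>p + 1\<close>, at a height \<open>m - Suc p\<close> that is even as
    \<open>extendable\<close> demands.\<close>
  define I where "I = {p. Suc p \<le> m \<and> even (m - Suc p)}"
  define ws where "ws p = square_block p (m - Suc p)" for p
  define u where "u p = M (Suc p) (m - Suc p) True False" for p
  define v where "v p = M (Suc p) (m - Suc p) True True" for p
  have vs: "adj_path vs" "set vs = {c. valid (Suc m) c}"
    "{L m False True, R m False True} \<in> list_edges vs"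
    "\<And>p q. 1 \<le> p \<Longrightarrow> p + q = m \<Longrightarrow> even q \<Longrightarrow> block_edge p q \<in> list_edges vs"
    using ext by (auto simp: extendable_def)
  have "\<exists>vs1. adj_path vs1 \<and> set vs1 = set vs \<union> (\<Union>p\<in>I. set (ws p)) \<and>
      list_edges vs - (\<lambda>p. {u p, v p}) ` I \<union> (\<Union>p\<in>I. list_edges (ws p)) \<subseteq> list_edges vs1"
  proof (rule adj_path_insert_family[OF _ vs(1)])
    show "finite I" by (rule finite_subset[of _ "{..m}"]) (auto simp: I_def)
    show "adj_path (ws p) \<and> ws p \<noteq> [] \<and> adj (u p) (hd (ws p)) \<and> adj (last (ws p)) (v p)" for p
      unfolding ws_def using adj_path_square_block[of p "m - Suc p"]
      by (auto simp: square_block_def u_def v_def adj_def)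
    show "{u p, v p} \<in> list_edges vs" if "p \<in> I" for p
      using vs(4)[of "Suc p" "m - Suc p"] that by (auto simp: u_def v_def I_def block_edge_def)
    show "{u p, v p} \<noteq> {u p', v p'} \<and> set (ws p) \<inter> set (ws p') = {}"
      if "p \<in> I" "p' \<in> I" "p \<noteq> p'" for p p'
    proof -
      \<comment> \<open>All members of \<open>I\<close> have the same parity, so different pairs of
        columns do not overlap.\<close>
      have "p \<noteq> Suc p'" "p' \<noteq> Suc p" using that unfolding I_def mem_Collect_eq by presburger+
      then have "set (ws p) \<inter> set (ws p') = {}"
        using that by (intro cell_disjointI) (auto simp: ws_def set_square_block)
      then show ?thesis using that by (auto simp: u_def v_def doubleton_eq_iff)
    qed
    show "set (ws p) \<inter> set vs = {}" if "p \<in> I" for p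
      using that by (intro cell_disjointI) (auto simp: ws_def vs(2) set_square_block I_def)
  qed
  then obtain vs1 where vs1: "adj_path vs1" "set vs1 = set vs \<union> (\<Union>p\<in>I. set (ws p))"
      "list_edges vs - (\<lambda>p. {u p, v p}) ` I \<union> (\<Union>p\<in>I. list_edges (ws p)) \<subseteq> list_edges vs1"
    by blast
  have mem_ws: "M x y s t \<in> set (ws p) \<longleftrightarrow> (x = p \<or> x = Suc p) \<and> (x + y = m + 1 \<or> x + y = m + 2)"
    if "p \<in> I" for p x y s t
    using that by (auto simp: ws_def set_square_block I_def)
  \<comment> \<open>The pairs cover the columns \<open>0..m\<close> for odd \<open>m\<close> and
    \<open>1..m\<close> for even \<open>m\<close>.\<close>
  have cover: "(\<exists>p\<in>I. x = p \<or> x = Suc p) \<longleftrightarrow> x \<le> m \<and> (x = 0 \<longrightarrow> odd m)" for x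
  proof (cases x)
    case 0
    then show ?thesis using m by (auto simp: I_def)
  next
    case (Suc y)
    have "y \<in> I \<or> Suc y \<in> I" if "Suc y \<le> m"
    proof (cases "Suc y = m")
      case False
      then show ?thesis using that by (auto simp: I_def)
    qed (auto simp: I_def)
    then have "\<exists>p\<in>I. x = p \<or> x = Suc p" if "x \<le> m" using that Suc by auto
    then show ?thesis using Suc by (auto simp: I_def)
  qed
  have mem1: "M p q s t \<in> set vs1 \<longleftrightarrow> p + q \<le> m + 2 \<and> p \<le> m \<and> (p = 0 \<longrightarrow> q \<le> m \<or> odd m)" for p q s t
  proof -
    have "M p q s t \<in> set vs1 \<longleftrightarrow>
        p + q \<le> m \<or> (\<exists>p'\<in>I. p = p' \<or> p = Suc p') \<and> (p + q = m + 1 \<or> p + q = m + 2)"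
      unfolding vs1(2) vs(2) by (auto simp: mem_ws)
    then show ?thesis unfolding cover by auto
  qed
  have mem1': "L p s t \<in> set vs1 \<longleftrightarrow> p \<le> m" "R p s t \<in> set vs1 \<longleftrightarrow> p \<le> m" for p s t
    by (auto simp: vs1(2) vs(2) ws_def set_square_block)
  \<comment> \<open>These are the last two cells of the block for \<open>p = m - 1\<close>, whose
    base height is 0. The hypothesis \<open>1 \<le> m\<close> guarantees that this block
    exists.\<close>
  have e1: "{M m 2 True True, M m 1 True True} \<in> list_edges vs1"
  proof -
    have "m - 1 \<in> I" using m by (auto simp: I_def)
    moreover have "{M m 2 True True, M m 1 True True} \<in> list_edges (ws (m - 1))"
      using m by (simp add: ws_def square_block_def doubleton_eq_iff)
    ultimately show ?thesis using vs1(3) by blast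
  qed
  have "\<exists>vs2. adj_path vs2 \<and> set vs2 = set vs1 \<union> set (corner_block m) \<and>
     list_edges vs1 - {{M m 2 True True, M m 1 True True}} \<union> list_edges (corner_block m) \<subseteq> list_edges vs2"
  proof (rule adj_path_insert[OF vs1(1) e1 adj_path_corner_block])
    show "set (corner_block m) \<inter> set vs1 = {}"
      by (intro cell_disjointI) (auto simp: set_corner_block mem1)
  qed (auto simp: corner_block_def adj_def)
  then obtain vs2 where vs2: "adj_path vs2" "set vs2 = set vs1 \<union> set (corner_block m)"
     "list_edges vs1 - {{M m 2 True True, M m 1 True True}} \<union> list_edges (corner_block m) \<subseteq> list_edges vs2"
    by blast
  \<comment> \<open>For even \<open>m\<close> this edge lies in the block for columns 1 and 2.
    Lowering \<open>p\<close> from its two ends leads to the two ends of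
    \<open>column_block m\<close>.\<close>
  define k where "k = {M 1 m True True, M 1 (m + 1) True True}"
  have "\<exists>vs3. adj_path vs3 \<and> set vs3 = set vs2 \<union> (if odd m then {} else set (column_block m)) \<and>
     list_edges vs2 - {k} \<subseteq> list_edges vs3"
  proof (cases "odd m")
    case True
    then show ?thesis using vs2(1) by auto
  next
    case False
    then have m2: "2 \<le> m" using m by presburger
    have "k \<in> list_edges vs2"
    proof -
      have "1 \<in> I" using m2 False by (auto simp: I_def)
      moreover have "k \<in> list_edges (ws 1)"
        using m2 by (simp add: ws_def square_block_def k_def doubleton_eq_iff)
      ultimately have "k \<in> list_edges vs1" using vs1(3) by blast
      moreover have "k \<noteq> {M m 2 True True, M m 1 True True}" using m2 by (auto simp: k_def doubleton_eq_iff)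
      ultimately show ?thesis using vs2(3) by blast
    qed
    then have "\<exists>vs3. adj_path vs3 \<and> set vs3 = set vs2 \<union> set (column_block m) \<and>
      list_edges vs2 - {{M 1 m True True, M 1 (m + 1) True True}} \<union> list_edges (column_block m) \<subseteq> list_edges vs3"
      unfolding k_def
    proof (rule adj_path_insert[OF vs2(1) _ adj_path_column_block])
      show "set (column_block m) \<inter> set vs2 = {}"
        using False by (intro cell_disjointI) (auto simp: set_column_block set_corner_block vs2(2) mem1)
    qed (auto simp: column_block_def adj_def)
    then show ?thesis using False by (auto simp: k_def)
  qed
  then obtain vs3 where vs3: "adj_path vs3"
      "set vs3 = set vs2 \<union> (if odd m then {} else set (column_block m))"
      "list_edges vs2 - {k} \<subseteq> list_edges vs3"
    by blast
  let ?lr = "{L m False True, R m False True}"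
  have lr: "?lr \<in> list_edges vs3"
  proof -
    have "?lr \<notin> (\<lambda>p. {u p, v p}) ` I" "?lr \<noteq> {M m 2 True True, M m 1 True True}" "?lr \<noteq> k"
      by (auto simp: u_def v_def k_def doubleton_eq_iff)
    then show ?thesis using vs(3) vs1(3) vs2(3) vs3(3) by blast
  qed
  have "\<exists>vs4. adj_path vs4 \<and> set vs4 = set vs3 \<union> set (LR_block m) \<and>
      list_edges vs3 - {?lr} \<union> list_edges (LR_block m) \<subseteq> list_edges vs4"
  proof (rule adj_path_insert[OF vs3(1) lr adj_path_LR_block])
    show "set (LR_block m) \<inter> set vs3 = {}"
      by (intro cell_disjointI) (auto simp: set_LR_block vs3(2) vs2(2) mem1' set_corner_block set_column_block)
  qed (auto simp: LR_block_def adj_def)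
  then obtain vs4 where vs4: "adj_path vs4" "set vs4 = set vs3 \<union> set (LR_block m)"
      "list_edges vs3 - {?lr} \<union> list_edges (LR_block m) \<subseteq> list_edges vs4"
    by blast
  have "c \<in> set vs4 \<longleftrightarrow> valid (Suc (m + 2)) c" for c
  proof (cases c)
    case (M p q s t)
    have "c \<in> set vs4 \<longleftrightarrow> M p q s t \<in> set vs1 \<or> M p q s t \<in> set (corner_block m) \<or> (even m \<and> M p q s t \<in> set (column_block m))"
      by (auto simp: M vs4(2) vs3(2) vs2(2) set_LR_block)
    also have "\<dots> \<longleftrightarrow> p + q \<le> m + 2"
      unfolding mem1 set_corner_block set_column_block by auto
    finally show ?thesis by (auto simp: M)
  next
    case (L p s t)
    then show ?thesis
      by (auto simp: vs4(2) vs3(2) vs2(2) mem1' set_LR_block set_corner_block set_column_block)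
  next
    case (R p s t)
    then show ?thesis
      by (auto simp: vs4(2) vs3(2) vs2(2) mem1' set_LR_block set_corner_block set_column_block)
  qed
  then have "set vs4 = {c. valid (Suc (m + 2)) c}" by auto
  moreover have "{L (m + 2) False True, R (m + 2) False True} \<in> list_edges vs4"
    using subsetD[OF vs4(3), of "{L (m + 2) False True, R (m + 2) False True}"]
    by (simp add: LR_block_def)
  \<comment> \<open>The places for the next round: for \<open>q = 0\<close> in the corner block,
    otherwise in the square block of columns \<open>p - 1\<close> and \<open>p\<close>. None of them
    is among the edges removed by later insertions.\<close>
  moreover have "block_edge p q \<in> list_edges vs4" if "1 \<le> p" "p + q = m + 2" "even q" for p q
  proof -
    have "block_edge p q \<in> list_edges vs2"
    proof (cases "q = 0")
      case True
      then have "block_edge p q \<in> list_edges (corner_block m)"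
        using that by (simp add: corner_block_def block_edge_def doubleton_eq_iff)
      then show ?thesis using vs2(3) by blast
    next
      case False
      then have q: "2 \<le> q" using that by presburger
      then have "p - 1 \<in> I" using that unfolding I_def mem_Collect_eq by presburger
      moreover have "block_edge p q \<in> list_edges (ws (p - 1))"
      proof -
        have "m - p + 2 = q" using that q by simp
        then show ?thesis using that by (simp add: ws_def square_block_def block_edge_def)
      qed
      ultimately have "block_edge p q \<in> list_edges vs1" using vs1(3) by blast
      moreover have "block_edge p q \<noteq> {M m 2 True True, M m 1 True True}"
        by (auto simp: block_edge_def doubleton_eq_iff)
      ultimately show ?thesis using vs2(3) by blast
    qed
    moreover have "block_edge p q \<noteq> k" "block_edge p q \<noteq> ?lr"
      by (auto simp: block_edge_def k_def doubleton_eq_iff)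
    ultimately show ?thesis using vs3(3) vs4(3) by blast
  qed
  ultimately show ?thesis using vs4(1) unfolding extendable_def by blast
qed

text \<open>Steps of two from 2 and from 5 reach exactly 2 and all numbers from 4 on; 5 is a
  starting value because \<open>5 - 2\<close> lies outside the range.\<close>

lemma extendable_ex: "a = 2 \<or> 4 \<le> a \<Longrightarrow> \<exists>vs. extendable (a - 1) vs"
proof (induction a rule: less_induct)
  case (less a)
  consider "a = 2" | "a = 5" | "a \<ge> 4" "a - 2 = 2 \<or> 4 \<le> a - 2" using less.prems by linarith
  then show ?case
  proof cases
    case 3
    then obtain vs where "extendable (a - 2 - 1) vs" using less.IH[of "a - 2"] by auto
    from extendable_step[OF this] 3 show ?thesis by (simp add: numeral_eq_Suc Suc_diff_Suc)
  qed (use extendable_base_2 extendable_base_5 in auto)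
qed

lemma hamilton_path_if_extendable:
  assumes a: "1 \<le> a" and "extendable (a - 1) vs"
  shows "has_hamilton_path (colorful_flip_graph [a, 1, 1, 1, 1, 1])"
proof -
  let ?G = "colorful_flip_graph [a, 1, 1, 1, 1, 1]"
  have vs: "distinct vs" "successively adj vs" "set vs = {c. valid a c}"
    using assms by (auto simp: extendable_def adj_path_def)
  have "L 0 True True \<in> set vs" using a vs(3) by simp
  then have "vs \<noteq> []" by auto
  moreover have "distinct (map (tri a) vs)" using vs inj_on_tri[of a] by (simp add: distinct_map)
  moreover have "set (map (tri a) vs) = fst ?G" using vs(3) colorful_flip_graph_nodes[OF a] by simp
  moreover have "successively (\<lambda>u v. {u, v} \<in> snd ?G) (map (tri a) vs)"
    unfolding successively_map
  proof (rule successively_mono[OF vs(2)])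
    fix x y assume "x \<in> set vs" "y \<in> set vs" "adj x y"
    then show "{tri a x, tri a y} \<in> snd ?G"
      using vs(3) flip_arc[of x y a] flip_arc[of y x a] colorful_flip_graph_edges[OF a, of x y]
      by (auto simp: adj_def)
  qed
  ultimately show ?thesis unfolding has_hamilton_path_def hamilton_path_def by blast
qed

theorem theorem5:
  shows "(\<forall>a::nat. a \<ge> 1 \<longrightarrow> \<not> has_hamilton_cycle (colorful_flip_graph [a, 1, 1, 1, 1, 1])) \<and>
         (\<forall>a::nat. a = 2 \<or> a \<ge> 4 \<longrightarrow> has_hamilton_path (colorful_flip_graph [a, 1, 1, 1, 1, 1]))"
proof (intro conjI allI impI)
  fix a :: nat assume a: "a = 2 \<or> a \<ge> 4"
  then show "has_hamilton_path (colorful_flip_graph [a, 1, 1, 1, 1, 1])"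
    using extendable_ex[OF a] hamilton_path_if_extendable[of a] by auto
qed (use no_hamilton_cycle in blast)

end
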